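(* Let $t$ be a positive integer and let $(G,\sigma)$ be a signed graph with no negative loop and with no $\tilde K_t$-minor. Then $\chi_{fb}(G,\sigma)\leq 2t-2$.
   Context: A signed graph $(G,\sigma)$ is a graph (loops and parallel edges allowed) with a signature $\sigma:E(G)\to\{+,-\}$. Switching at a vertex multiplies the signs of all incident edges by $-$. A signed graph $(H,\pi)$ is a minor of $(G,\sigma)$ if it is obtained by a sequence of vertex deletions, edge deletions, contractions of positive edges, and switchings. For a graph $K$, $\tilde K$ is obtained by replacing every edge of $K$ by a positive and a negative parallel edge. A vertex set is balanced if it induces no negative cycle (sign of a cycle = product of its edge signs). A fractional balanced coloring of $(G,\sigma)$ assigns non-negative weights to the balanced sets of $(G,\sigma)$ such that every vertex lies in balanced sets of total weight at least $1$; the fractional balanced chromatic number $\chi_{fb}(G,\sigma)$ is the infimum of the total weight over all fractional balanced colorings. *)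

theory Defs
  imports Complex_Main
begin

text \<open>Signed multigraphs (loops and parallel edges allowed). Each edge has a set of
  one (loop) or two (ordinary edge) end vertices; the sign True means positive.\<close>

record ('v, 'e) sgraph =
  verts :: "'v set"
  edges :: "'e set"
  ends  :: "'e \<Rightarrow> 'v set"
  sgn   :: "'e \<Rightarrow> bool"

definition signed_graph :: "('v, 'e) sgraph \<Rightarrow> bool" where
  "signed_graph G \<longleftrightarrow> finite (verts G) \<and> finite (edges G) \<and>
     (\<forall>e\<in>edges G. ends G e \<subseteq> verts G \<and> 1 \<le> card (ends G e) \<and> card (ends G e) \<le> 2)"

definition is_loop :: "('v, 'e) sgraph \<Rightarrow> 'e \<Rightarrow> bool" where
  "is_loop G e \<longleftrightarrow> card (ends G e) = 1"

definition has_negative_loop :: "('v, 'e) sgraph \<Rightarrow> bool" where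
  "has_negative_loop G \<longleftrightarrow> (\<exists>e\<in>edges G. is_loop G e \<and> \<not> sgn G e)"

definition delete_vertex :: "('v, 'e) sgraph \<Rightarrow> 'v \<Rightarrow> ('v, 'e) sgraph" where
  "delete_vertex G v = G\<lparr> verts := verts G - {v},
                          edges := {e \<in> edges G. v \<notin> ends G e} \<rparr>"

definition delete_edge :: "('v, 'e) sgraph \<Rightarrow> 'e \<Rightarrow> ('v, 'e) sgraph" where
  "delete_edge G e = G\<lparr> edges := edges G - {e} \<rparr>"

definition contract_edge :: "('v, 'e) sgraph \<Rightarrow> 'e \<Rightarrow> 'v \<Rightarrow> 'v \<Rightarrow> ('v, 'e) sgraph" where
  "contract_edge G e u v = G\<lparr> verts := verts G - {v},
                              edges := edges G - {e},
                              ends := (\<lambda>f. (\<lambda>x. if x = v then u else x) ` ends G f) \<rparr>"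

text \<open>Switching at v flips the signs of the non-loop edges at v (a loop is incident
  twice with v, so its sign is unchanged).\<close>
definition switch_at :: "('v, 'e) sgraph \<Rightarrow> 'v \<Rightarrow> ('v, 'e) sgraph" where
  "switch_at G v = G\<lparr> sgn := (\<lambda>f. if v \<in> ends G f \<and> \<not> is_loop G f
                                     then \<not> sgn G f else sgn G f) \<rparr>"

inductive minor_step :: "('v, 'e) sgraph \<Rightarrow> ('v, 'e) sgraph \<Rightarrow> bool" where
  del_v: "v \<in> verts G \<Longrightarrow> minor_step G (delete_vertex G v)"
| del_e: "e \<in> edges G \<Longrightarrow> minor_step G (delete_edge G e)"
| contr: "e \<in> edges G \<Longrightarrow> sgn G e \<Longrightarrow> ends G e = {u, v} \<Longrightarrow> u \<noteq> v \<Longrightarrow>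
          minor_step G (contract_edge G e u v)"
| switch: "v \<in> verts G \<Longrightarrow> minor_step G (switch_at G v)"

inductive minor :: "('v, 'e) sgraph \<Rightarrow> ('v, 'e) sgraph \<Rightarrow> bool" where
  refl: "minor G G"
| step: "minor G H \<Longrightarrow> minor_step H H' \<Longrightarrow> minor G H'"

definition sg_iso :: "('v, 'e) sgraph \<Rightarrow> ('w, 'f) sgraph \<Rightarrow> bool" where
  "sg_iso G H \<longleftrightarrow> (\<exists>\<phi> \<psi>. bij_betw \<phi> (verts G) (verts H) \<and> bij_betw \<psi> (edges G) (edges H) \<and>
      (\<forall>e\<in>edges G. ends H (\<psi> e) = \<phi> ` ends G e \<and> sgn H (\<psi> e) = sgn G e))"

definition Ktilde :: "nat \<Rightarrow> (nat, nat \<times> nat \<times> bool) sgraph" where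
  "Ktilde t = \<lparr> verts = {..<t},
               edges = {(i, j, s). i < j \<and> j < t},
               ends = (\<lambda>(i, j, s). {i, j}),
               sgn = (\<lambda>(i, j, s). s) \<rparr>"

definition has_minor :: "('v, 'e) sgraph \<Rightarrow> ('w, 'f) sgraph \<Rightarrow> bool" where
  "has_minor G K \<longleftrightarrow> (\<exists>H. minor G H \<and> sg_iso H K)"

text \<open>A cycle: distinct vertices v_0..v_{k-1} and distinct edges e_0..e_{k-1} (k \<ge> 1)
  with e_i joining v_i and v_{i+1 mod k} (k = 1: a loop, k = 2: two parallel edges).\<close>
definition is_cycle :: "('v, 'e) sgraph \<Rightarrow> 'v list \<Rightarrow> 'e list \<Rightarrow> bool" where
  "is_cycle G vs es \<longleftrightarrow> length vs = length es \<and> length es \<ge> 1 \<and>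
     distinct vs \<and> distinct es \<and> set vs \<subseteq> verts G \<and> set es \<subseteq> edges G \<and>
     (\<forall>i < length es. ends G (es ! i) = {vs ! i, vs ! ((i + 1) mod length vs)})"

definition negative_cycle :: "('v, 'e) sgraph \<Rightarrow> 'v list \<Rightarrow> 'e list \<Rightarrow> bool" where
  "negative_cycle G vs es \<longleftrightarrow> is_cycle G vs es \<and> odd (length (filter (\<lambda>e. \<not> sgn G e) es))"

definition balanced :: "('v, 'e) sgraph \<Rightarrow> 'v set \<Rightarrow> bool" where
  "balanced G X \<longleftrightarrow> X \<subseteq> verts G \<and> \<not> (\<exists>vs es. negative_cycle G vs es \<and> set vs \<subseteq> X)"

definition fractional_balanced_coloring :: "('v, 'e) sgraph \<Rightarrow> ('v set \<Rightarrow> real) \<Rightarrow> bool" where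
  "fractional_balanced_coloring G w \<longleftrightarrow>
     (\<forall>X. w X \<ge> 0) \<and> (\<forall>X. \<not> balanced G X \<longrightarrow> w X = 0) \<and>
     (\<forall>v\<in>verts G. (\<Sum>X\<in>{X. balanced G X \<and> v \<in> X}. w X) \<ge> 1)"

definition chi_fb :: "('v, 'e) sgraph \<Rightarrow> real" where
  "chi_fb G = Inf {(\<Sum>X\<in>{X. balanced G X}. w X) | w. fractional_balanced_coloring G w}"

end

theory Submission
  imports Defs
begin

text \<open>Partition the vertices greedily into maximal connected sets that can be switched to be
  all positive. By maximality, two adjacent parts are joined by edges of both relative signs, so
  contracting the parts gives a graph \<open>H\<close> with every edge doubled; a \<open>K\<^sub>t\<close> minor of \<open>H\<close> yields a
  \<open>Ktilde t\<close> minor, and the union of a stable set of parts is balanced. It remains to show, as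
  Reed and Seymour did, that \<open>H\<close> has fractional chromatic number at most \<open>2 (t - 1)\<close>.

  For given vertex weights, \<open>H\<close> is decomposed into connected bags, each containing a stable set
  of at least half its weight, such that the bags touching any component of what remains are
  pairwise adjacent. Giving each new bag a colour distinct from those of the at most \<open>t - 2\<close> bags
  touching its component, some colour class of bags contains a stable set of at least the
  fraction \<open>1 / (2 (t - 1))\<close> of the total weight. The bag chosen in a component maximizes twice the
  weight of the stable set minus the weight of the bag, among the connected sets touching some
  earlier bag; the point is that it then touches all of them.\<close>

subsection \<open>Connected sets\<close>

definition touch :: "('a \<Rightarrow> 'a \<Rightarrow> bool) \<Rightarrow> 'a set \<Rightarrow> 'a set \<Rightarrow> bool" where
  "touch R A B \<longleftrightarrow> (\<exists>a\<in>A. \<exists>b\<in>B. R a b)"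

text \<open>Connectivity by cuts instead of paths, a form that passes to unions and images without
  any handling of walks.\<close>

definition conn :: "('a \<Rightarrow> 'a \<Rightarrow> bool) \<Rightarrow> 'a set \<Rightarrow> bool" where
  "conn R X \<longleftrightarrow> X \<noteq> {} \<and> (\<forall>A\<subseteq>X. A \<noteq> {} \<longrightarrow> A \<noteq> X \<longrightarrow> touch R A (X - A))"

lemma touch_mono: "touch R A B \<Longrightarrow> A \<subseteq> A' \<Longrightarrow> B \<subseteq> B' \<Longrightarrow> touch R A' B'"
  unfolding touch_def by blast

lemma touch_sym: "symp R \<Longrightarrow> touch R A B \<Longrightarrow> touch R B A"
  unfolding touch_def by (meson sympD)

lemma touch_Un1: "touch R (A \<union> A') B \<longleftrightarrow> touch R A B \<or> touch R A' B"
  unfolding touch_def by blast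

lemma touch_Un2: "touch R A (B \<union> B') \<longleftrightarrow> touch R A B \<or> touch R A B'"
  unfolding touch_def by blast

lemma conn_singleton: "conn R {x}"
  unfolding conn_def by blast

lemma conn_nonempty: "conn R X \<Longrightarrow> X \<noteq> {}"
  unfolding conn_def by blast

lemma conn_cut: "conn R X \<Longrightarrow> A \<subseteq> X \<Longrightarrow> A \<noteq> {} \<Longrightarrow> A \<noteq> X \<Longrightarrow> touch R A (X - A)"
  unfolding conn_def by blast

lemma conn_Un:
  assumes R: "symp R" and X: "conn R X" and Y: "conn R Y" and XY: "touch R X Y \<or> X \<inter> Y \<noteq> {}"
  shows "conn R (X \<union> Y)"
  unfolding conn_def
proof (intro conjI allI impI)
  show "X \<union> Y \<noteq> {}" using conn_nonempty[OF X] by blast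
  fix A assume A: "A \<subseteq> X \<union> Y" "A \<noteq> {}" "A \<noteq> X \<union> Y"
  show "touch R A (X \<union> Y - A)"
  proof (cases "A \<inter> X \<noteq> {} \<and> A \<inter> X \<noteq> X")
    case True
    then have "touch R (A \<inter> X) (X - A \<inter> X)" using conn_cut[OF X, of "A \<inter> X"] by blast
    then show ?thesis by (rule touch_mono) auto
  next
    case nX: False
    show ?thesis
    proof (cases "A \<inter> Y \<noteq> {} \<and> A \<inter> Y \<noteq> Y")
      case True
      then have "touch R (A \<inter> Y) (Y - A \<inter> Y)" using conn_cut[OF Y, of "A \<inter> Y"] by blast
      then show ?thesis by (rule touch_mono) auto
    next
      case False
      with nX A have "(X \<subseteq> A \<and> A \<inter> Y = {}) \<or> (Y \<subseteq> A \<and> A \<inter> X = {})" by blast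
      then show ?thesis
      proof
        assume *: "X \<subseteq> A \<and> A \<inter> Y = {}"
        then have "touch R X Y" using XY by blast
        then show ?thesis by (rule touch_mono) (use * in auto)
      next
        assume *: "Y \<subseteq> A \<and> A \<inter> X = {}"
        then have "touch R Y X" using XY touch_sym[OF R] by blast
        then show ?thesis by (rule touch_mono) (use * in auto)
      qed
    qed
  qed
qed

text \<open>The preimage of a cut of the image is a cut of \<open>X\<close>. An edge across it has
  distinct end images, so \<open>step\<close> may ignore the edges that \<open>f\<close> collapses;
  contraction needs exactly this.\<close>

lemma conn_image:
  assumes X: "conn R X"
    and step: "\<And>x y. x \<in> X \<Longrightarrow> y \<in> X \<Longrightarrow> R x y \<Longrightarrow> f x \<noteq> f y \<Longrightarrow> R' (f x) (f y)"
  shows "conn R' (f ` X)"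
  unfolding conn_def
proof (intro conjI allI impI)
  show "f ` X \<noteq> {}" using conn_nonempty[OF X] by blast
  fix A assume A: "A \<subseteq> f ` X" "A \<noteq> {}" "A \<noteq> f ` X"
  let ?B = "{x \<in> X. f x \<in> A}"
  have "touch R ?B (X - ?B)"
    by (rule conn_cut[OF X]) (use A in auto)
  then obtain x y where "x \<in> X" "f x \<in> A" "y \<in> X" "f y \<notin> A" "R x y"
    unfolding touch_def by blast
  moreover from this have "R' (f x) (f y)" by (intro step) auto
  ultimately show "touch R' A (f ` X - A)" unfolding touch_def by blast
qed

lemma conn_cong:
  assumes "conn R X" "\<And>x y. x \<in> X \<Longrightarrow> y \<in> X \<Longrightarrow> R x y \<Longrightarrow> x \<noteq> y \<Longrightarrow> R' x y"
  shows "conn R' X"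
  using conn_image[of R X id R'] assms by simp

text \<open>A cut of the union either splits some member, which is connected, or respects all
  members and is then a cut of \<open>F\<close>. This turns connected families of parts into
  connected vertex sets.\<close>

lemma conn_Union:
  assumes F: "conn Q F" and X: "\<And>X. X \<in> F \<Longrightarrow> conn R X"
    and Q: "\<And>X Y. X \<in> F \<Longrightarrow> Y \<in> F \<Longrightarrow> Q X Y \<Longrightarrow> touch R X Y"
  shows "conn R (\<Union>F)"
  unfolding conn_def
proof (intro conjI allI impI)
  obtain X where "X \<in> F" using conn_nonempty[OF F] by blast
  then show "\<Union>F \<noteq> {}" using conn_nonempty[OF X] by blast
  fix A assume A: "A \<subseteq> \<Union>F" "A \<noteq> {}" "A \<noteq> \<Union>F"
  show "touch R A (\<Union>F - A)"
  proof (cases "\<exists>X\<in>F. A \<inter> X \<noteq> {} \<and> A \<inter> X \<noteq> X")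
    case True
    then obtain Y where Y: "Y \<in> F" "A \<inter> Y \<noteq> {}" "A \<inter> Y \<noteq> Y" by blast
    then have "touch R (A \<inter> Y) (Y - A \<inter> Y)" using conn_cut[OF X, of Y "A \<inter> Y"] by blast
    then show ?thesis by (rule touch_mono) (use Y in auto)
  next
    case False
    let ?B = "{X \<in> F. X \<subseteq> A}"
    have "?B \<noteq> {}"
    proof -
      obtain a where "a \<in> A" using A by blast
      then obtain Y where "Y \<in> F" "a \<in> Y" using A by blast
      then show ?thesis using False \<open>a \<in> A\<close> by blast
    qed
    moreover have "?B \<noteq> F" using A by blast
    ultimately have "touch Q ?B (F - ?B)" using conn_cut[OF F, of ?B] by blast
    then obtain Y Z where YZ: "Y \<in> F" "Y \<subseteq> A" "Z \<in> F" "\<not> Z \<subseteq> A" "Q Y Z"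
      unfolding touch_def by blast
    then have "A \<inter> Z = {}" using False by blast
    moreover have "touch R Y Z" using Q YZ by blast
    ultimately show ?thesis using YZ by (elim touch_mono) auto
  qed
qed

text \<open>A path of least length from \<open>N\<close> to a neighbour of \<open>Z\<close>, inside
  \<open>C - Z\<close>. Minimality gives the extra properties: a later visit to \<open>N\<close>, an
  early edge to \<open>Z\<close> or a chord would each allow a shorter path.\<close>

lemma shortest_path:
  assumes C: "conn R C" and Z: "Z \<subseteq> C" "Z \<noteq> {}" and N: "N \<subseteq> C" "N \<noteq> {}" "N \<inter> Z = {}"
  obtains q :: "nat \<Rightarrow> 'a" and m where
    "q 0 \<in> N" "\<forall>i. 0 < i \<longrightarrow> i \<le> m \<longrightarrow> q i \<notin> N"
    "\<forall>i\<le>m. q i \<in> C - Z" "\<forall>i<m. R (q i) (q (Suc i))"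
    "touch R {q m} Z" "\<forall>i<m. \<not> touch R {q i} Z"
    "\<forall>i j. Suc i < j \<longrightarrow> j \<le> m \<longrightarrow> \<not> R (q i) (q j)" "inj_on q {..m}"
proof -
  define path where "path q m \<longleftrightarrow> q 0 \<in> N \<and> (\<forall>i\<le>m. q i \<in> C - Z) \<and> (\<forall>i<m. R (q i) (q (Suc i)))"
    for q :: "nat \<Rightarrow> 'a" and m
  \<comment> \<open>The vertices reachable from \<open>N\<close> while avoiding \<open>Z\<close>. An
    edge leaving this set within \<open>C\<close> must end in \<open>Z\<close>, as otherwise it
    would extend a path.\<close>
  define K where "K = {x. \<exists>q m. path q m \<and> q m = x}"
  have "K \<noteq> {}"
  proof -
    obtain x where "x \<in> N" using N by blast
    then have "path (\<lambda>_. x) 0" using N unfolding path_def by auto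
    then show ?thesis unfolding K_def by blast
  qed
  moreover have KC: "K \<subseteq> C - Z" unfolding K_def path_def by blast
  ultimately have "touch R K (C - K)" using conn_cut[OF C, of K] Z by blast
  then obtain a b where ab: "a \<in> K" "b \<in> C" "b \<notin> K" "R a b" unfolding touch_def by blast
  obtain q m where qm: "path q m" "q m = a" using ab unfolding K_def by blast
  have "b \<in> Z"
  proof (rule ccontr)
    assume "b \<notin> Z"
    then have "path (q(Suc m := b)) (Suc m)"
      using qm ab unfolding path_def by (auto simp: le_Suc_eq less_Suc_eq)
    then show False using ab(3) unfolding K_def by force
  qed
  then have "touch R {q m} Z" using ab qm unfolding touch_def by blast
  then have ex: "\<exists>m q. path q m \<and> touch R {q m} Z" using qm by blast
  define M where "M = (LEAST m. \<exists>q. path q m \<and> touch R {q m} Z)"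
  obtain q where q: "path q M" "touch R {q M} Z" using LeastI_ex[OF ex] unfolding M_def by blast
  have least: "M \<le> m'" if "path q' m'" "touch R {q' m'} Z" for q' m'
    unfolding M_def by (rule Least_le) (use that in blast)
  have notN: "q i \<notin> N" if "0 < i" "i \<le> M" for i
  proof
    assume "q i \<in> N"
    then have "path (\<lambda>k. q (k + i)) (M - i)" using q that unfolding path_def by auto
    then show False using least[of "\<lambda>k. q (k + i)" "M - i"] q that by auto
  qed
  have nt: "\<not> touch R {q i} Z" if "i < M" for i
  proof
    assume "touch R {q i} Z"
    moreover have "path q i" using q that unfolding path_def by auto
    ultimately show False using least that by fastforce
  qed
  have ind: "\<not> R (q i) (q j)" if ij: "Suc i < j" "j \<le> M" for i j
  proof
    assume R: "R (q i) (q j)"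
    \<comment> \<open>The chord replaces the stretch from \<open>i\<close> to \<open>j\<close>: the
      index shift is such that \<open>p (Suc i) = q j\<close>.\<close>
    define p where "p k = (if k \<le> i then q k else q (k + (j - Suc i)))" for k
    have "path p (M - (j - Suc i))"
      unfolding path_def
    proof (intro conjI allI impI)
      show "p 0 \<in> N" using q unfolding path_def p_def by auto
      show "p k \<in> C - Z" if "k \<le> M - (j - Suc i)" for k
        using q ij that unfolding path_def p_def by auto
      show "R (p k) (p (Suc k))" if k: "k < M - (j - Suc i)" for k
      proof -
        consider "k < i" | "k = i" | "k > i" by linarith
        then show ?thesis
        proof cases
          case 1
          then show ?thesis using q ij unfolding path_def p_def by auto
        next
          case 2
          then show ?thesis using R ij unfolding p_def by auto
        next
          case 3
          then have "k + (j - Suc i) < M" using k by linarith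
          then show ?thesis using q 3 unfolding path_def p_def by auto
        qed
      qed
    qed
    moreover have "p (M - (j - Suc i)) = q M" using ij unfolding p_def by auto
    ultimately show False using least[of p "M - (j - Suc i)"] q ij by auto
  qed
  have ne: "q i \<noteq> q j" if "i < j" "j \<le> M" for i j
  proof
    assume eq: "q i = q j"
    show False
    proof (cases i)
      case 0
      then show False using eq notN[of j] that q unfolding path_def by auto
    next
      case (Suc i')
      then have "R (q i') (q j)" using eq q that unfolding path_def by (metis Suc_le_lessD less_le_trans nat_less_le)
      then show False using ind[of i' j] that Suc by auto
    qed
  qed
  have "inj_on q {..M}"
    by (rule inj_onI) (metis atMost_iff linorder_neq_iff ne)
  then show thesis using that[of q M] q notN nt ind unfolding path_def by blast
qed

subsection \<open>The Reed--Seymour decomposition\<close>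

text \<open>Call \<open>2 * sum w S - sum w X\<close> the slack of a connected set \<open>X\<close> with stable
  subset \<open>S\<close>. If a set of maximum slack missed \<open>B\<close>, take a shortest path from the
  neighbourhood of \<open>B\<close> to \<open>X\<close> and split it into its two parity classes: by parity of its
  length, either the path itself or its union with \<open>X\<close> has larger slack.\<close>

lemma heavy_set_touches_all:
  fixes w :: "'a \<Rightarrow> real"
  assumes R: "symp R" "irreflp R" and C: "conn R C" "finite C"
    and B: "touch R B C"
    and light: "\<And>Y S. Y \<subseteq> C \<Longrightarrow> conn R Y \<Longrightarrow> touch R B Y \<Longrightarrow> S \<subseteq> Y \<Longrightarrow> \<not> touch R S S \<Longrightarrow>
      \<not> touch R B S \<Longrightarrow> 2 * sum w S < sum w Y"
    and X: "X \<subseteq> C" "conn R X" "S \<subseteq> X" "\<not> touch R S S"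
    and max: "\<And>Y T. Y \<subseteq> C \<Longrightarrow> conn R Y \<Longrightarrow> touch R B Y \<Longrightarrow> T \<subseteq> Y \<Longrightarrow> \<not> touch R T T \<Longrightarrow>
      2 * sum w T - sum w Y \<le> 2 * sum w S - sum w X"
  shows "touch R B X"
proof (rule ccontr)
  assume nBX: "\<not> touch R B X"
  define N where "N = {x \<in> C. touch R B {x}}"
  have BN: "touch R B Y \<longleftrightarrow> Y \<inter> N \<noteq> {}" if "Y \<subseteq> C" for Y
    using that unfolding N_def touch_def by auto
  have N: "N \<noteq> {}" "N \<subseteq> C" "N \<inter> X = {}"
    using BN[of C] B BN[OF X(1)] nBX unfolding N_def by auto
  obtain q m where
    "q 0 \<in> N" "\<forall>i. 0 < i \<longrightarrow> i \<le> m \<longrightarrow> q i \<notin> N"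
    "\<forall>i\<le>m. q i \<in> C - X" "\<forall>i<m. R (q i) (q (Suc i))"
    "touch R {q m} X" "\<forall>i<m. \<not> touch R {q i} X"
    "\<forall>i j. Suc i < j \<longrightarrow> j \<le> m \<longrightarrow> \<not> R (q i) (q j)" "inj_on q {..m}"
    by (rule shortest_path[OF C(1) X(1) conn_nonempty[OF X(2)] N(2,1,3)])
  note q = this[rule_format]
  define Q where "Q = q ` {..m}"
  define E where "E = q ` {i. i \<le> m \<and> odd i}"
  define D where "D = q ` {i. i \<le> m \<and> even i}"
  have QC: "Q \<subseteq> C" and QX: "Q \<inter> X = {}" using q(3) unfolding Q_def by auto
  have "conn R (q ` {..i})" if "i \<le> m" for i
    using that
  proof (induction i)
    case 0
    then show ?case by (simp add: conn_singleton)
  next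
    case (Suc i)
    have "touch R (q ` {..i}) {q (Suc i)}" using q(4)[of i] Suc.prems unfolding touch_def by auto
    then have "conn R (q ` {..i} \<union> {q (Suc i)})"
      using Suc conn_Un[OF R(1) _ conn_singleton, of "q ` {..i}" "q (Suc i)"] by simp
    moreover have "q ` {..Suc i} = q ` {..i} \<union> {q (Suc i)}" by (auto simp: atMost_Suc)
    ultimately show ?case by simp
  qed
  then have Qc: "conn R Q" unfolding Q_def by blast
  \<comment> \<open>The path is induced, so adjacent vertices have indices of opposite parity; each
    parity class is therefore stable.\<close>
  have nR: "\<not> R (q i) (q j)" if "i \<le> m" "j \<le> m" "even i = even j" for i j
  proof -
    have "i = j \<or> Suc i < j \<or> Suc j < i" using that(3) by presburger
    then consider "i = j" | "Suc i < j" | "Suc j < i" by blast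
    then show ?thesis
    proof cases
      case 1 then show ?thesis using R(2) by (simp add: irreflpD)
    next
      case 2 then show ?thesis using q(7) that by blast
    next
      case 3 then show ?thesis using q(7)[of j i] that R(1) by (meson sympD)
    qed
  qed
  have Es: "\<not> touch R E E" and Ds: "\<not> touch R D D"
    using nR unfolding E_def D_def touch_def by auto
  have EQ: "E \<subseteq> Q" and DQ: "D \<subseteq> Q" unfolding E_def D_def Q_def by auto
  \<comment> \<open>The vertex at index 0 is the only one on the path that sees \<open>B\<close>, so
    the odd class has no edge to \<open>B\<close>.\<close>
  have EN: "E \<inter> N = {}" using q(2) unfolding E_def by (auto simp: odd_pos)
  have QN: "touch R B Q" using BN[OF QC] q(1) unfolding Q_def by auto
  have fin: "finite X" "finite Q" using X(1) C(2) QC finite_subset by auto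
  have wQ: "sum w Q = sum w D + sum w E"
  proof -
    have "Q = D \<union> E" unfolding Q_def D_def E_def by auto
    moreover have "D \<inter> E = {}"
      using q(8) unfolding D_def E_def inj_on_def by fastforce
    moreover have "finite D" "finite E" using fin EQ DQ finite_subset by auto
    ultimately show ?thesis by (simp add: sum.union_disjoint)
  qed
  have lightQ: "2 * sum w E < sum w Q"
    using light[OF QC Qc QN EQ Es] EN EQ QC BN[of E] by blast
  have "touch R Q X" using touch_mono[OF q(5), of Q X] unfolding Q_def by auto
  then have XQ: "conn R (X \<union> Q)" using conn_Un[OF R(1) X(2) Qc] touch_sym[OF R(1)] by blast
  have XQC: "X \<union> Q \<subseteq> C" using X QC by auto
  have XQN: "touch R B (X \<union> Q)" using QN by (simp add: touch_Un2)
  have wXQ: "sum w (X \<union> Q) = sum w X + sum w Q"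
    using fin QX by (simp add: sum.union_disjoint Int_commute)
  have wS: "sum w (S \<union> T) = sum w S + sum w T" if "T \<subseteq> Q" for T
  proof (rule sum.union_disjoint)
    show "finite S" using X(3) fin finite_subset by auto
    show "finite T" using that fin finite_subset by auto
    show "S \<inter> T = {}" using X(3) that QX by auto
  qed
  \<comment> \<open>Only the last vertex of the path sees \<open>X\<close>, so a parity class that
    omits it can be added to \<open>S\<close>.\<close>
  have far: "\<not> touch R (S \<union> T) (S \<union> T)"
    if "\<not> touch R T T" "T \<subseteq> q ` {i. i < m}" for T
  proof -
    have "\<not> touch R T X" using that q(6) unfolding touch_def by force
    then have "\<not> touch R T S" using X(3) touch_mono[of R T S T X] by blast
    then show ?thesis using that X(4) touch_sym[OF R(1)] by (auto simp: touch_Un1 touch_Un2)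
  qed
  show False
  proof (cases "even m")
    case True
    \<comment> \<open>The end \<open>q m\<close> lies in \<open>D\<close>. That
      \<open>X \<union> Q\<close> is light for \<open>S \<union> E\<close> says exactly that
      \<open>Q\<close> with \<open>D\<close> has slack above the maximum.\<close>
    have "i \<noteq> m" if "odd i" for i using that True by auto
    then have "E \<subseteq> q ` {i. i < m}" unfolding E_def by (force simp: order_le_less)
    then have st: "\<not> touch R (S \<union> E) (S \<union> E)" by (rule far[OF Es])
    have "\<not> touch R B S" using nBX X(3) touch_mono[of R B S B X] by blast
    moreover have "\<not> touch R B E" using EN EQ QC BN[of E] by blast
    ultimately have "2 * sum w (S \<union> E) < sum w (X \<union> Q)"
      using light[OF XQC XQ XQN _ st] X(3) EQ by (auto simp: touch_Un2)
    then have "2 * sum w S - sum w X < 2 * sum w D - sum w Q"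
      using wS[OF EQ] wXQ wQ by simp
    then show False using max[OF QC Qc QN DQ Ds] by simp
  next
    case False
    \<comment> \<open>The end \<open>q m\<close> lies in \<open>E\<close>. Maximality against
      \<open>X \<union> Q\<close> with \<open>S \<union> D\<close> gives
      \<open>2 * sum w D \<le> sum w Q\<close>; added to \<open>lightQ\<close>, this contradicts
      \<open>wQ\<close>.\<close>
    have "i \<noteq> m" if "even i" for i using that False by auto
    then have "D \<subseteq> q ` {i. i < m}" unfolding D_def by (force simp: order_le_less)
    then have st: "\<not> touch R (S \<union> D) (S \<union> D)" by (rule far[OF Ds])
    have "2 * sum w (S \<union> D) - sum w (X \<union> Q) \<le> 2 * sum w S - sum w X"
      using max[OF XQC XQ XQN _ st] X(3) DQ by auto
    then show False using wS[OF DQ] wXQ wQ lightQ by simp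
  qed
qed

definition clique_minor :: "('a \<Rightarrow> 'a \<Rightarrow> bool) \<Rightarrow> 'a set \<Rightarrow> 'a set set \<Rightarrow> bool" where
  "clique_minor R V K \<longleftrightarrow> finite K \<and> (\<forall>X\<in>K. X \<subseteq> V \<and> conn R X) \<and>
     (\<forall>X\<in>K. \<forall>Y\<in>K. X \<noteq> Y \<longrightarrow> X \<inter> Y = {} \<and> touch R X Y)"

lemma clique_minor_subset: "clique_minor R V K \<Longrightarrow> K' \<subseteq> K \<Longrightarrow> clique_minor R V K'"
  unfolding clique_minor_def by (meson finite_subset subset_iff)

text \<open>\<open>U\<close> is the part of the graph not yet decomposed and \<open>F\<close> the family of bags removed so
  far. The last hypothesis records that each bag was chosen maximal: nothing can be added to
  it without losing slack.\<close>

lemma half_weight_colour_classes: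
  fixes w :: "'a \<Rightarrow> real" and col :: "'a set \<Rightarrow> nat"
  assumes R: "symp R" "irreflp R" and V: "finite V" and w: "\<And>v. w v \<ge> 0"
    and no_clique: "\<And>K. clique_minor R V K \<Longrightarrow> card K \<le> n"
    and "U \<subseteq> V" "finite F"
    and "\<And>B. B \<in> F \<Longrightarrow> conn R B \<and> B \<subseteq> V - U"
    and "\<And>A B. A \<in> F \<Longrightarrow> B \<in> F \<Longrightarrow> A \<noteq> B \<Longrightarrow> A \<inter> B = {}"
    and "\<And>A B Y. A \<in> F \<Longrightarrow> B \<in> F \<Longrightarrow> A \<noteq> B \<Longrightarrow> Y \<subseteq> U \<Longrightarrow> conn R Y \<Longrightarrow>
      touch R A Y \<Longrightarrow> touch R B Y \<Longrightarrow> touch R A B \<and> col A \<noteq> col B"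
    and "\<And>B Y S. B \<in> F \<Longrightarrow> Y \<subseteq> U \<Longrightarrow> conn R Y \<Longrightarrow> touch R B Y \<Longrightarrow>
      S \<subseteq> Y \<Longrightarrow> \<not> touch R S S \<Longrightarrow> \<not> touch R B S \<Longrightarrow> 2 * sum w S < sum w Y"
  shows "\<exists>T. (\<forall>c<n. T c \<subseteq> U \<and> \<not> touch R (T c) (T c) \<and>
      (\<forall>B\<in>F. col B = c \<longrightarrow> \<not> touch R B (T c))) \<and> sum w U \<le> 2 * (\<Sum>c<n. sum w (T c))"
  using assms(6-)
proof (induction "card U" arbitrary: U F col rule: less_induct)
  case less
  note U = \<open>U \<subseteq> V\<close> and finF = \<open>finite F\<close> and bags = less.prems(3) and disj = less.prems(4)
    and meet = less.prems(5) and light = less.prems(6)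
  have finU: "finite U" using U V finite_subset by blast
  show ?case
  proof (cases "U = {}")
    case True
    then show ?thesis by (intro exI[of _ "\<lambda>_. {}"]) (auto simp: touch_def)
  next
    case False
    have finC: "finite {C. C \<subseteq> U \<and> conn R C}" using finU by simp
    have "{C. C \<subseteq> U \<and> conn R C} \<noteq> {}" using False conn_singleton[of R] by blast
    \<comment> \<open>A connected set of largest size is a whole component of \<open>U\<close>:
      anything connected that touches it could be merged into it.\<close>
    then obtain C where C: "C \<subseteq> U" "conn R C"
      and Cmax: "\<And>Y. Y \<subseteq> U \<Longrightarrow> conn R Y \<Longrightarrow> card Y \<le> card C"
      using finite_has_maximal[of "card ` {C. C \<subseteq> U \<and> conn R C}"] finC
      by auto (metis (no_types, lifting) nat_le_linear)
    have comp: "Y \<subseteq> C" if "Y \<subseteq> U" "conn R Y" "touch R C Y" for Y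
    proof -
      have "conn R (C \<union> Y)" using conn_Un[OF R(1) C(2)] that by blast
      then have "card (C \<union> Y) \<le> card C" using Cmax C that by simp
      moreover have "finite (C \<union> Y)" using C that finU finite_subset by blast
      ultimately show ?thesis using card_seteq[of "C \<union> Y" C] by blast
    qed
    have finCC: "finite C" using C finU finite_subset by blast
    define FC where "FC = {B \<in> F. touch R B C}"
    \<comment> \<open>Candidates for the new bag in the component \<open>C\<close>, each with a
      stable set. If old bags touch \<open>C\<close>, a candidate has to touch only one of them;
      that the chosen one touches all will follow from its maximum slack.\<close>
    define cand where "cand = {(X, S). X \<subseteq> C \<and> conn R X \<and> (FC = {} \<or> (\<exists>B\<in>FC. touch R B X)) \<and>
      S \<subseteq> X \<and> \<not> touch R S S}"
    define slack where "slack = (\<lambda>(X, S). 2 * sum w S - sum w X)"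
    have cfin: "finite cand"
      by (rule finite_subset[of _ "Pow C \<times> Pow C"]) (use finCC in \<open>auto simp: cand_def\<close>)
    have single: "\<not> touch R {x} {x}" for x using R(2) by (auto simp: touch_def irreflpD)
    obtain x where x: "x \<in> C" "FC = {} \<or> (\<exists>B\<in>FC. touch R B {x})"
    proof (cases "FC = {}")
      case True
      then show ?thesis using that conn_nonempty[OF C(2)] by blast
    next
      case False
      then obtain B where "B \<in> FC" "touch R B C" unfolding FC_def by blast
      then show ?thesis using that unfolding touch_def by blast
    qed
    have xc: "({x}, {x}) \<in> cand" using x conn_singleton single unfolding cand_def by auto
    define mx where "mx = Max (slack ` cand)"
    have mxle: "slack p \<le> mx" if "p \<in> cand" for p unfolding mx_def using that cfin by simp
    define best where "best = {p \<in> cand. slack p = mx}"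
    have "mx \<in> slack ` cand" unfolding mx_def using cfin xc by (intro Max_in) auto
    then have bne: "best \<noteq> {}" unfolding best_def by auto
    have bfin: "finite best" unfolding best_def using cfin by simp
    \<comment> \<open>Among the pairs of maximum slack, one with largest \<open>X\<close>: this
      tie-break makes the \<open>light\<close> inequality strict for the new bag.\<close>
    obtain X S where XS: "(X, S) \<in> best" and XSmax: "\<And>Y T. (Y, T) \<in> best \<Longrightarrow> card Y \<le> card X"
    proof -
      have "Max ((\<lambda>p. card (fst p)) ` best) \<in> (\<lambda>p. card (fst p)) ` best"
        using bne bfin by (intro Max_in) auto
      then obtain p where p: "p \<in> best" "card (fst p) = Max ((\<lambda>p. card (fst p)) ` best)" by auto
      have "card (fst r) \<le> card (fst p)" if "r \<in> best" for r
        unfolding p(2) using that bfin by simp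
      then show thesis using that[of "fst p" "snd p"] p(1) by force
    qed
    have X: "X \<subseteq> C" "conn R X" "FC = {} \<or> (\<exists>B\<in>FC. touch R B X)" "S \<subseteq> X" "\<not> touch R S S"
      and sl: "2 * sum w S - sum w X = mx"
      using XS unfolding best_def cand_def slack_def by auto
    have half: "sum w X \<le> 2 * sum w S"
      using mxle[OF xc] w[of x] sl unfolding slack_def by simp
    have all: "touch R B X" if B: "B \<in> FC" for B
    proof (rule heavy_set_touches_all[OF R C(2) finCC _ _ X(1,2,4,5)])
      show "touch R B C" using B unfolding FC_def by auto
      show "2 * sum w T < sum w Y" if "Y \<subseteq> C" "conn R Y" "touch R B Y" "T \<subseteq> Y"
        "\<not> touch R T T" "\<not> touch R B T" for Y T
        using light[of B Y T] that B C(1) unfolding FC_def by auto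
      show "2 * sum w T - sum w Y \<le> 2 * sum w S - sum w X"
        if "Y \<subseteq> C" "conn R Y" "touch R B Y" "T \<subseteq> Y" "\<not> touch R T T" for Y T
        using mxle[of "(Y, T)"] that B sl unfolding cand_def slack_def by auto
    qed
    have XU: "X \<subseteq> U" using X(1) C(1) by simp
    have XB: "X \<inter> B = {}" if "B \<in> F" for B using bags[OF that] XU by blast
    have XF: "X \<notin> F" using XB conn_nonempty[OF X(2)] by blast
    have FCF: "FC \<subseteq> F" "finite FC" using finF unfolding FC_def by auto
    \<comment> \<open>The bags in \<open>FC\<close> touch each other because they all touch the
      connected set \<open>C\<close>, and \<open>X\<close> touches each of them. Hence
      \<open>FC\<close> has at most \<open>n - 1\<close> bags, and one of the \<open>n\<close>
      colours is free for \<open>X\<close>.\<close>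
    have "clique_minor R V (insert X FC)"
      unfolding clique_minor_def
    proof (intro conjI ballI impI)
      show "finite (insert X FC)" using FCF by simp
      show "A \<subseteq> V" "conn R A" if "A \<in> insert X FC" for A
        using that bags FCF X(2) XU U by blast+
      fix A B assume AB: "A \<in> insert X FC" "B \<in> insert X FC" "A \<noteq> B"
      show "A \<inter> B = {}" using AB XB disj FCF by blast
      show "touch R A B"
      proof (cases "A = X \<or> B = X")
        case True
        then show ?thesis using AB all touch_sym[OF R(1)] by blast
      next
        case False
        then have "A \<in> FC" "B \<in> FC" using AB by auto
        then show ?thesis using meet[of A B C] AB(3) C FCF unfolding FC_def by blast
      qed
    qed
    then have "card (insert X FC) \<le> n" by (rule no_clique)
    then have "card (col ` FC) < n"
      using XF FCF card_image_le[of FC col] by (auto simp: card_insert_if split: if_splits)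
    then have "\<not> {..<n} \<subseteq> col ` FC" using card_mono[of "col ` FC" "{..<n}"] FCF by auto
    then obtain c0 where c0: "c0 < n" "c0 \<notin> col ` FC" by blast
    define col' where "col' = col(X := c0)"
    have colF: "col' B = col B" if "B \<in> F" for B using that XF unfolding col'_def by auto
    have toX: "Y \<subseteq> C" if "Y \<subseteq> U - X" "conn R Y" "touch R X Y" for Y
      using comp[of Y] that X(1) touch_mono[of R X Y C Y] by blast
    \<comment> \<open>A connected \<open>Y\<close> outside \<open>X\<close> that touches
      \<open>X\<close> stays in \<open>C\<close>, so any old bag touching \<open>Y\<close> belongs
      to \<open>FC\<close>.\<close>
    have newbag: "touch R X B \<and> c0 \<noteq> col B"
      if B: "B \<in> F" and Y: "Y \<subseteq> U - X" "conn R Y" "touch R X Y" "touch R B Y" for B Y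
    proof -
      have "touch R B C" using toX Y touch_mono[of R B Y B C] by blast
      then have "B \<in> FC" using B unfolding FC_def by blast
      then show ?thesis using all c0 touch_sym[OF R(1)] by blast
    qed
    have "\<exists>T. (\<forall>c<n. T c \<subseteq> U - X \<and> \<not> touch R (T c) (T c) \<and>
      (\<forall>B\<in>insert X F. col' B = c \<longrightarrow> \<not> touch R B (T c))) \<and>
      sum w (U - X) \<le> 2 * (\<Sum>c<n. sum w (T c))"
    proof (rule less.hyps)
      show "card (U - X) < card U"
        using XU conn_nonempty[OF X(2)] finU by (intro psubset_card_mono) auto
      show "U - X \<subseteq> V" "finite (insert X F)" using U finF by auto
      show "conn R B \<and> B \<subseteq> V - (U - X)" if "B \<in> insert X F" for B
        using that bags[of B] X(2) XU U by blast
      show "A \<inter> B = {}" if "A \<in> insert X F" "B \<in> insert X F" "A \<noteq> B" for A B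
        using that disj XB by blast
      show "touch R A B \<and> col' A \<noteq> col' B"
        if AB: "A \<in> insert X F" "B \<in> insert X F" "A \<noteq> B"
          and Y: "Y \<subseteq> U - X" "conn R Y" "touch R A Y" "touch R B Y" for A B Y
      proof -
        consider "A = X" "B \<in> F" | "B = X" "A \<in> F" | "A \<in> F" "B \<in> F" using AB by blast
        then show ?thesis
        proof cases
          case 1
          then show ?thesis using newbag[of B Y] Y colF unfolding col'_def by auto
        next
          case 2
          then show ?thesis
            using newbag[of A Y] Y colF touch_sym[OF R(1), of X A] unfolding col'_def by auto
        next
          case 3
          then show ?thesis using meet[of A B Y] AB(3) Y colF by auto
        qed
      qed
      show "2 * sum w T < sum w Y"
        if B: "B \<in> insert X F" and Y: "Y \<subseteq> U - X" "conn R Y" "touch R B Y"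
          and T: "T \<subseteq> Y" "\<not> touch R T T" "\<not> touch R B T" for B Y T
      proof (cases "B = X")
        case False
        then show ?thesis using light[of B Y T] B Y T by auto
      next
        case True
        show ?thesis
        proof (rule ccontr)
          \<comment> \<open>Then enlarging the bag by \<open>Y\<close> and its stable set by
            \<open>T\<close> would not lower the slack, against the maximum or, in case of a tie,
            against the size of \<open>X\<close>.\<close>
          assume n: "\<not> ?thesis"
          have YC: "Y \<subseteq> C" using toX Y True by blast
          have XY: "conn R (X \<union> Y)" using conn_Un[OF R(1) X(2) Y(2)] Y(3) True by blast
          have "FC = {} \<or> (\<exists>B\<in>FC. touch R B (X \<union> Y))" using X(3) by (auto simp: touch_Un2)
          moreover have "\<not> touch R S T" using T(3) True X(4) touch_mono[of R S T X T] by blast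
          then have "\<not> touch R (S \<union> T) (S \<union> T)"
            using X(5) T(2) touch_sym[OF R(1)] by (auto simp: touch_Un1 touch_Un2)
          ultimately have c: "(X \<union> Y, S \<union> T) \<in> cand"
            using XY YC X(1,4) T(1) unfolding cand_def by auto
          have fin: "finite X" "finite Y" "finite S" "finite T"
            using finCC X(1,4) YC T(1) by (meson finite_subset)+
          have dis: "X \<inter> Y = {}" "S \<inter> T = {}" using Y(1) X(4) T(1) by auto
          have "slack (X \<union> Y, S \<union> T) = 2 * sum w S - sum w X + (2 * sum w T - sum w Y)"
            using fin dis by (simp add: slack_def sum.union_disjoint)
          then have "slack (X \<union> Y, S \<union> T) = mx" using mxle[OF c] n sl by simp
          then have "card (X \<union> Y) \<le> card X" using XSmax c unfolding best_def by blast
          then have "card Y = 0" using fin dis by (simp add: card_Un_disjoint)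
          then show False using fin conn_nonempty[OF Y(2)] by simp
        qed
      qed
    qed
    then obtain T where T: "\<And>c. c < n \<Longrightarrow> T c \<subseteq> U - X \<and> \<not> touch R (T c) (T c) \<and>
        (\<forall>B\<in>insert X F. col' B = c \<longrightarrow> \<not> touch R B (T c))"
      and wT: "sum w (U - X) \<le> 2 * (\<Sum>c<n. sum w (T c))" by blast
    \<comment> \<open>The stable set of the new bag joins colour \<open>c0\<close>. The recursion
      kept \<open>T c0\<close> away from \<open>X\<close>, and no old bag of colour
      \<open>c0\<close> touches \<open>C\<close>, so all requirements persist.\<close>
    define T' where "T' = T(c0 := T c0 \<union> S)"
    have finS: "finite S" using X(4) XU finU by (meson finite_subset)
    have finT: "finite (T c0)" using T[OF c0(1)] finU by (meson finite_Diff finite_subset)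
    have "sum w (T c0 \<union> S) = sum w (T c0) + sum w S"
      using T[OF c0(1)] X(4) finS finT by (intro sum.union_disjoint) auto
    then have "(\<Sum>c<n. sum w (T' c)) = (\<Sum>c<n. sum w (T c) + (if c = c0 then sum w S else 0))"
      unfolding T'_def by (intro sum.cong) auto
    also have "\<dots> = (\<Sum>c<n. sum w (T c)) + sum w S"
      using c0(1) by (simp add: sum.distrib)
    finally have wT': "(\<Sum>c<n. sum w (T' c)) = (\<Sum>c<n. sum w (T c)) + sum w S" .
    have wU: "sum w U = sum w (U - X) + sum w X"
      using XU finU by (metis sum.subset_diff)
    have "T' c \<subseteq> U \<and> \<not> touch R (T' c) (T' c) \<and> (\<forall>B\<in>F. col B = c \<longrightarrow> \<not> touch R B (T' c))"
      if c: "c < n" for c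
    proof (cases "c = c0")
      case False
      then show ?thesis using T[OF c] colF unfolding T'_def by auto
    next
      case True
      have "\<not> touch R X (T c0)" using T[OF c0(1)] unfolding col'_def by auto
      then have "\<not> touch R S (T c0)" using X(4) touch_mono[of R S "T c0" X "T c0"] by blast
      then have "\<not> touch R (T c0 \<union> S) (T c0 \<union> S)"
        using T[OF c0(1)] X(5) touch_sym[OF R(1)] by (auto simp: touch_Un1 touch_Un2)
      moreover have "\<not> touch R B (T c0 \<union> S)" if B: "B \<in> F" "col B = c0" for B
      proof -
        have "B \<notin> FC" using B c0(2) by blast
        then have "\<not> touch R B S" using B X(1,4) touch_mono[of R B S B C] unfolding FC_def by blast
        then show ?thesis using T[OF c0(1)] B colF by (auto simp: touch_Un2)
      qed
      ultimately show ?thesis using True T[OF c0(1)] X(4) XU unfolding T'_def by auto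
    qed
    then show ?thesis using wT wT' wU half by (intro exI[of _ T']) auto
  qed
qed

text \<open>Starting with no bags, the \<open>n\<close> stable sets \<open>T c\<close> together
  carry at least half of the weight, so one of them carries at least the average share.\<close>

lemma heavy_stable_set:
  fixes w :: "'a \<Rightarrow> real"
  assumes R: "symp R" "irreflp R" and V: "finite V" and w: "\<And>v. w v \<ge> 0"
    and no_clique: "\<And>K. clique_minor R V K \<Longrightarrow> card K \<le> n" and n: "n \<ge> 1"
  shows "\<exists>T\<subseteq>V. \<not> touch R T T \<and> sum w V \<le> 2 * real n * sum w T"
proof -
  obtain T where T: "\<And>c. c < n \<Longrightarrow> T c \<subseteq> V \<and> \<not> touch R (T c) (T c)"
    and wT: "sum w V \<le> 2 * (\<Sum>c<n. sum w (T c))"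
    using half_weight_colour_classes[OF R V, of w n V "{}" "\<lambda>_. 0"] w no_clique by auto
  show ?thesis
  proof (rule ccontr)
    assume n': "\<not> ?thesis"
    have "sum w (T c) < sum w V / (2 * real n)" if "c < n" for c
      using n' T[OF that] n by (auto simp: field_simps)
    then have "(\<Sum>c<n. sum w (T c)) < (\<Sum>c<n. sum w V / (2 * real n))"
      using n by (intro sum_strict_mono) (auto simp: lessThan_empty_iff)
    then show False using wT n by simp
  qed
qed

subsection \<open>From heavy sets to fractional covers\<close>

text \<open>An approximate form of linear programming duality. Mixing a little of the set that is
  heavy for the current coverage deficits into a distribution decreases the sum of their
  squares to first order, so the infimum of that potential is zero.\<close>

lemma convex_cover_approx:
  fixes \<B> :: "'a set set"
  assumes V: "finite V" and \<B>: "finite \<B>" and r: "r > 0"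
    and heavy: "\<And>w. (\<And>v. w v \<ge> 0) \<Longrightarrow> \<exists>S\<in>\<B>. S \<subseteq> V \<and> sum w V \<le> r * sum w S"
    and \<epsilon>: "\<epsilon> > 0"
  shows "\<exists>p :: 'a set \<Rightarrow> real. (\<forall>S. p S \<ge> 0) \<and> (\<forall>S. S \<notin> \<B> \<longrightarrow> p S = 0) \<and> sum p \<B> = 1 \<and>
    (\<forall>v\<in>V. sum p {S \<in> \<B>. v \<in> S} \<ge> 1 / r - \<epsilon>)"
proof -
  define dist where "dist p \<longleftrightarrow> (\<forall>S. p S \<ge> 0) \<and> (\<forall>S. S \<notin> \<B> \<longrightarrow> p S = 0) \<and> sum p \<B> = 1"
    for p :: "'a set \<Rightarrow> real"
  define cov where "cov p v = sum p {S \<in> \<B>. v \<in> S}" for p :: "'a set \<Rightarrow> real" and v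
  define def where "def p v = max 0 (1 / r - cov p v)" for p v
  define \<Phi> where "\<Phi> p = (\<Sum>v\<in>V. (def p v)\<^sup>2)" for p
  define m where "m = Inf (\<Phi> ` Collect dist)"
  have \<Phi>0: "\<Phi> p \<ge> 0" for p unfolding \<Phi>_def by (simp add: sum_nonneg)
  have bdd: "bdd_below (\<Phi> ` Collect dist)" using \<Phi>0 by (intro bdd_belowI[of _ 0]) auto
  have mle: "m \<le> \<Phi> p" if "dist p" for p unfolding m_def using that bdd by (intro cInf_lower) auto
  obtain S0 where S0: "S0 \<in> \<B>" using heavy[of "\<lambda>_. 0"] by auto
  have "dist (\<lambda>S. if S = S0 then 1 else 0)" unfolding dist_def using S0 \<B> by auto
  then have ne: "\<Phi> ` Collect dist \<noteq> {}" by blast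
  \<comment> \<open>Moving weight \<open>\<eta>\<close> onto the set that is heavy for the deficits
    lowers the potential by at least \<open>2 * \<eta> * \<Phi> p\<close>, up to an error of
    \<open>\<eta>\<^sup>2\<close> per vertex.\<close>
  have step: "m \<le> (1 - 2 * \<eta>) * \<Phi> p + \<eta>\<^sup>2 * real (card V)"
    if p: "dist p" and \<eta>: "0 < \<eta>" "\<eta> \<le> 1" for p \<eta>
  proof -
    obtain S where S: "S \<in> \<B>" "S \<subseteq> V" "sum (def p) V \<le> r * sum (def p) S"
      using heavy[of "def p"] unfolding def_def by auto
    define p' where "p' X = (1 - \<eta>) * p X + (if X = S then \<eta> else 0)" for X
    have p': "dist p'"
      using p S(1) \<eta> \<B> unfolding dist_def p'_def
      by (auto simp: sum.distrib sum_distrib_left[symmetric])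
    have cov': "cov p' v = cov p v + \<eta> * (of_bool (v \<in> S) - cov p v)" for v
    proof -
      have "cov p' v = (1 - \<eta>) * cov p v + (\<Sum>X\<in>{S \<in> \<B>. v \<in> S}. if X = S then \<eta> else 0)"
        unfolding cov_def p'_def by (simp add: sum.distrib sum_distrib_left)
      also have "(\<Sum>X\<in>{S \<in> \<B>. v \<in> S}. if X = S then \<eta> else 0) = \<eta> * of_bool (v \<in> S)"
        using S(1) \<B> by simp
      finally show ?thesis by (simp add: algebra_simps)
    qed
    have cov01: "0 \<le> cov p v" "cov p v \<le> 1" for v
    proof -
      show "0 \<le> cov p v" using p unfolding cov_def dist_def by (auto intro: sum_nonneg)
      have "cov p v \<le> sum p \<B>" unfolding cov_def using p \<B> unfolding dist_def
        by (intro sum_mono2) auto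
      then show "cov p v \<le> 1" using p unfolding dist_def by simp
    qed
    have sq: "(def p' v)\<^sup>2 \<le> (def p v)\<^sup>2 - 2 * \<eta> * (def p v * (of_bool (v \<in> S) - cov p v)) + \<eta>\<^sup>2" for v
    proof -
      define g where "g = of_bool (v \<in> S) - cov p v"
      have g: "\<bar>g\<bar> \<le> 1" using cov01[of v] unfolding g_def by auto
      \<comment> \<open>If \<open>v\<close> is covered beyond the target, its deficit is 0 and can
        rise by at most the size of \<open>\<eta> * g\<close>; hence the absolute value.\<close>
      have "def p' v \<le> \<bar>def p v - \<eta> * g\<bar>"
        unfolding def_def cov' g_def[symmetric] by (auto simp: max_def abs_if)
      moreover have "0 \<le> def p' v" unfolding def_def by simp
      ultimately have "(def p' v)\<^sup>2 \<le> (def p v - \<eta> * g)\<^sup>2"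
        by (metis abs_le_square_iff abs_of_nonneg)
      also have "\<dots> = (def p v)\<^sup>2 - 2 * \<eta> * (def p v * g) + \<eta>\<^sup>2 * g\<^sup>2"
        by (simp add: power2_eq_square algebra_simps)
      also have "\<eta>\<^sup>2 * g\<^sup>2 \<le> \<eta>\<^sup>2"
        using g by (simp add: abs_square_le_1 mult_left_le)
      finally show ?thesis unfolding g_def by simp
    qed
    have dc: "def p v * (1 / r - cov p v) = (def p v)\<^sup>2" for v
      unfolding def_def by (auto simp: max_def power2_eq_square)
    have "\<Phi> p = (\<Sum>v\<in>V. def p v * (1 / r)) - (\<Sum>v\<in>V. def p v * cov p v)"
      unfolding \<Phi>_def dc[symmetric] by (simp add: sum_subtractf right_diff_distrib)
    also have "(\<Sum>v\<in>V. def p v * (1 / r)) = sum (def p) V / r"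
      by (simp add: sum_divide_distrib)
    also have "sum (def p) V / r \<le> sum (def p) S" using S(3) r by (simp add: field_simps)
    also have "sum (def p) S = (\<Sum>v\<in>V. def p v * of_bool (v \<in> S))"
    proof -
      have "(\<Sum>v\<in>V. def p v * of_bool (v \<in> S)) = (\<Sum>v\<in>V. if v \<in> S then def p v else 0)"
        by (intro sum.cong) auto
      also have "\<dots> = sum (def p) (V \<inter> S)" using V by (simp add: sum.inter_restrict)
      also have "V \<inter> S = S" using S(2) by blast
      finally show ?thesis by simp
    qed
    finally have gain: "\<Phi> p \<le> (\<Sum>v\<in>V. def p v * (of_bool (v \<in> S) - cov p v))"
      by (simp add: sum_subtractf right_diff_distrib)
    have "\<Phi> p' \<le> (\<Sum>v\<in>V. (def p v)\<^sup>2 - 2 * \<eta> * (def p v * (of_bool (v \<in> S) - cov p v)) + \<eta>\<^sup>2)"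
      unfolding \<Phi>_def by (intro sum_mono sq)
    also have "\<dots> = \<Phi> p - 2 * \<eta> * (\<Sum>v\<in>V. def p v * (of_bool (v \<in> S) - cov p v)) + \<eta>\<^sup>2 * real (card V)"
      by (simp add: \<Phi>_def sum.distrib sum_subtractf sum_distrib_left mult.commute)
    also have "\<dots> \<le> \<Phi> p - 2 * \<eta> * \<Phi> p + \<eta>\<^sup>2 * real (card V)"
      using gain \<eta> by (simp add: mult_left_mono)
    finally show ?thesis using mle[OF p'] by (simp add: algebra_simps)
  qed
  \<comment> \<open>Passing to the infimum over \<open>p\<close> gives
    \<open>m \<le> (1 - 2 * \<eta>) * m + \<eta>\<^sup>2 * card V\<close>; the bound on
    \<open>\<eta>\<close> keeps \<open>1 - 2 * \<eta>\<close> positive.\<close>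
  have m2: "2 * m \<le> \<eta> * real (card V)" if \<eta>: "0 < \<eta>" "\<eta> < 1 / 2" for \<eta>
  proof -
    have "(m - \<eta>\<^sup>2 * real (card V)) / (1 - 2 * \<eta>) \<le> m"
    proof (subst (2) m_def, rule cInf_greatest[OF ne])
      fix y assume "y \<in> \<Phi> ` Collect dist"
      then obtain p where "dist p" "y = \<Phi> p" by auto
      then show "(m - \<eta>\<^sup>2 * real (card V)) / (1 - 2 * \<eta>) \<le> y"
        using step[of p \<eta>] \<eta> by (simp add: field_simps)
    qed
    then have "\<eta> * (2 * m) \<le> \<eta> * (\<eta> * real (card V))"
      using \<eta> by (simp add: field_simps power2_eq_square)
    then show ?thesis using \<eta> by simp
  qed
  have "m \<le> 0"
  proof (rule ccontr)
    assume "\<not> m \<le> 0"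
    then have m: "m > 0" by simp
    \<comment> \<open>Small enough for \<open>\<eta> * card V \<le> m\<close>, which contradicts
      \<open>m2\<close>; the \<open>1/4\<close> keeps it below \<open>1/2\<close>.\<close>
    define \<eta> where "\<eta> = min (1/4) (m / (real (card V) + 1))"
    have \<eta>: "0 < \<eta>" "\<eta> < 1 / 2" "\<eta> \<le> m / (real (card V) + 1)" unfolding \<eta>_def using m by auto
    have "\<eta> * real (card V) \<le> \<eta> * (real (card V) + 1)" using \<eta> by simp
    also have "\<dots> \<le> m" using \<eta>(3) by (simp add: field_simps)
    finally show False using m2[OF \<eta>(1,2)] m by simp
  qed
  moreover have "0 < \<epsilon>\<^sup>2" using \<epsilon> by simp
  ultimately have "Inf (\<Phi> ` Collect dist) < \<epsilon>\<^sup>2" unfolding m_def[symmetric] by linarith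
  then obtain p where p: "dist p" "\<Phi> p < \<epsilon>\<^sup>2" using cInf_lessD[OF ne] by auto
  have "cov p v \<ge> 1 / r - \<epsilon>" if v: "v \<in> V" for v
  proof -
    have "(def p v)\<^sup>2 \<le> \<Phi> p" unfolding \<Phi>_def using v V by (intro member_le_sum) auto
    then have "(def p v)\<^sup>2 < \<epsilon>\<^sup>2" using p by simp
    then have "def p v < \<epsilon>" using \<epsilon> by (simp add: power2_less_imp_less)
    then show ?thesis unfolding def_def by auto
  qed
  then show ?thesis using p(1) unfolding dist_def cov_def by blast
qed

subsection \<open>Minors of signed graphs\<close>

lemma minor_trans: "minor H K \<Longrightarrow> minor G H \<Longrightarrow> minor G K"
  by (induction rule: minor.induct) (auto intro: minor.step)

lemma has_minor_trans: "minor G H \<Longrightarrow> has_minor H K \<Longrightarrow> has_minor G K"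
  unfolding has_minor_def using minor_trans by blast

text \<open>Switching at all of \<open>A\<close> at once: with both ends of an edge in
  \<open>A\<close> the two flips cancel, so only the parity counts.\<close>

definition switch_set :: "('v, 'e) sgraph \<Rightarrow> 'v set \<Rightarrow> ('v, 'e) sgraph" where
  "switch_set G A = G\<lparr>sgn := \<lambda>f. if is_loop G f then sgn G f
     else sgn G f = even (card (A \<inter> ends G f))\<rparr>"

lemma minor_switch_set:
  assumes "finite A" "A \<subseteq> verts G"
  shows "minor G (switch_set G A)"
  using assms
proof (induction A rule: finite_induct)
  case empty
  have "switch_set G {} = G" unfolding switch_set_def by (cases G) (auto simp: fun_eq_iff)
  then show ?case by (simp add: minor.refl)
next
  case (insert v A)
  have "switch_set G (insert v A) = switch_at (switch_set G A) v"
    unfolding switch_set_def switch_at_def is_loop_def using insert(1,2)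
    by (auto simp: fun_eq_iff)
  moreover have "minor_step (switch_set G A) (switch_at (switch_set G A) v)"
    by (rule minor_step.switch) (use insert in \<open>auto simp: switch_set_def\<close>)
  ultimately show ?case using insert by (auto intro: minor.step)
qed

lemma minor_delete_edges:
  assumes "finite D" "D \<subseteq> edges G"
  shows "minor G (G\<lparr>edges := edges G - D\<rparr>)"
  using assms
proof (induction D rule: finite_induct)
  case empty
  show ?case by (simp add: minor.refl)
next
  case (insert e D)
  let ?H = "G\<lparr>edges := edges G - D\<rparr>"
  have "G\<lparr>edges := edges G - insert e D\<rparr> = delete_edge ?H e"
    unfolding delete_edge_def by (simp add: Diff_insert[of "edges G"])
  moreover have "minor_step ?H (delete_edge ?H e)"
    by (rule minor_step.del_e) (use insert in auto)
  ultimately show ?case using insert by (auto intro: minor.step)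
qed

lemma minor_delete_isolated:
  assumes "finite D" "D \<subseteq> verts G" "\<And>e. e \<in> edges G \<Longrightarrow> ends G e \<inter> D = {}"
  shows "minor G (G\<lparr>verts := verts G - D\<rparr>)"
  using assms
proof (induction D rule: finite_induct)
  case empty
  show ?case by (simp add: minor.refl)
next
  case (insert v D)
  let ?H = "G\<lparr>verts := verts G - D\<rparr>"
  have "{e \<in> edges G. v \<notin> ends G e} = edges G" using insert(5) by blast
  then have "G\<lparr>verts := verts G - insert v D\<rparr> = delete_vertex ?H v"
    unfolding delete_vertex_def by (simp add: Diff_insert[of "verts G"])
  moreover have "minor_step ?H (delete_vertex ?H v)"
    by (rule minor_step.del_v) (use insert in auto)
  moreover have "minor G ?H" using insert by blast
  ultimately show ?case by (auto intro: minor.step)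
qed

definition joined :: "('v, 'e) sgraph \<Rightarrow> bool \<Rightarrow> 'v \<Rightarrow> 'v \<Rightarrow> bool" where
  "joined G b x y \<longleftrightarrow> (\<exists>e\<in>edges G. ends G e = {x, y} \<and> sgn G e = b)"

text \<open>One edge of \<open>G\<close> is selected for each edge of \<open>Ktilde t\<close> and
  the others are deleted; the vertices outside the image of \<open>b\<close> are then isolated and
  can be deleted too.\<close>

lemma Ktilde_minor_of_vertices:
  fixes G :: "('v, 'e) sgraph"
  assumes G: "signed_graph G" and b: "inj_on b {..<t}" "b ` {..<t} \<subseteq> verts G"
    and jn: "\<And>i j s. i < j \<Longrightarrow> j < t \<Longrightarrow> joined G s (b i) (b j)"
  shows "has_minor G (Ktilde t)"
proof -
  have "\<exists>\<epsilon>. \<forall>k\<in>edges (Ktilde t). case k of (i, j, s) \<Rightarrow>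
      \<epsilon> k \<in> edges G \<and> ends G (\<epsilon> k) = {b i, b j} \<and> sgn G (\<epsilon> k) = s"
    by (rule bchoice) (use jn in \<open>auto simp: Ktilde_def joined_def Bex_def\<close>)
  then obtain \<epsilon> where \<epsilon>0: "\<forall>k\<in>edges (Ktilde t). case k of (i, j, s) \<Rightarrow>
      \<epsilon> k \<in> edges G \<and> ends G (\<epsilon> k) = {b i, b j} \<and> sgn G (\<epsilon> k) = s" by blast
  have \<epsilon>: "\<epsilon> (i, j, s) \<in> edges G \<and> ends G (\<epsilon> (i, j, s)) = {b i, b j} \<and>
      sgn G (\<epsilon> (i, j, s)) = s" if "i < j" "j < t" for i j s
    using bspec[OF \<epsilon>0, of "(i, j, s)"] that by (simp add: Ktilde_def)
  let ?K = "edges (Ktilde t)"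
  define F where "F = \<epsilon> ` ?K"
  define W where "W = b ` {..<t}"
  have FE: "F \<subseteq> edges G" using \<epsilon> unfolding F_def Ktilde_def by auto
  have inj\<epsilon>: "inj_on \<epsilon> ?K"
  proof (rule inj_onI)
    fix k l assume kl: "k \<in> ?K" "l \<in> ?K" "\<epsilon> k = \<epsilon> l"
    obtain i j s i' j' s' where kl': "k = (i, j, s)" "l = (i', j', s')" by (metis prod_cases3)
    then have lt: "i < j" "j < t" "i' < j'" "j' < t" using kl unfolding Ktilde_def by auto
    have "s = s'" and "{b i, b j} = {b i', b j'}" using \<epsilon> lt kl(3) kl' by metis+
    then have "b ` {i, j} = b ` {i', j'}" by simp
    then have "{i, j} = {i', j'}" using inj_on_image_eq_iff[OF b(1), of "{i, j}" "{i', j'}"] lt by auto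
    then show "k = l" using \<open>s = s'\<close> lt kl' by (auto simp: doubleton_eq_iff)
  qed
  define H1 where "H1 = G\<lparr>edges := F\<rparr>"
  define H where "H = H1\<lparr>verts := W\<rparr>"
  have fin: "finite (verts G)" "finite (edges G)" using G unfolding signed_graph_def by auto
  have "minor G (G\<lparr>edges := edges G - (edges G - F)\<rparr>)"
    by (rule minor_delete_edges) (use fin in auto)
  moreover have "edges G - (edges G - F) = F" using FE by blast
  ultimately have m1: "minor G H1" unfolding H1_def by simp
  have "minor H1 (H1\<lparr>verts := verts H1 - (verts G - W)\<rparr>)"
  proof (rule minor_delete_isolated)
    show "finite (verts G - W)" "verts G - W \<subseteq> verts H1" using fin unfolding H1_def by auto
    fix e assume "e \<in> edges H1"
    then have "e \<in> F" unfolding H1_def by simp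
    then obtain i j s where "i < j" "j < t" "e = \<epsilon> (i, j, s)" unfolding F_def Ktilde_def by auto
    then show "ends H1 e \<inter> (verts G - W) = {}" using \<epsilon>[of i j s] unfolding H1_def W_def by auto
  qed
  moreover have "verts H1 - (verts G - W) = W" using b(2) unfolding H1_def W_def by auto
  ultimately have m2: "minor H1 H" unfolding H_def by simp
  have "sg_iso H (Ktilde t)"
    unfolding sg_iso_def
  proof (intro exI conjI ballI)
    let ?\<phi> = "the_inv_into {..<t} b" and ?\<psi> = "the_inv_into ?K \<epsilon>"
    show "bij_betw ?\<phi> (verts H) (verts (Ktilde t))"
      unfolding H_def W_def by (simp add: Ktilde_def bij_betw_the_inv_into bij_betw_imageI b(1))
    show "bij_betw ?\<psi> (edges H) ?K"
      unfolding H_def H1_def F_def by (simp add: bij_betw_the_inv_into bij_betw_imageI inj\<epsilon>)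
    fix e assume "e \<in> edges H"
    then have "e \<in> \<epsilon> ` ?K" unfolding H_def H1_def F_def by simp
    then obtain i j s where e: "i < j" "j < t" "e = \<epsilon> (i, j, s)" unfolding Ktilde_def by auto
    then have k: "(i, j, s) \<in> ?K" unfolding Ktilde_def by simp
    have \<psi>: "?\<psi> e = (i, j, s)" using the_inv_into_f_f[OF inj\<epsilon> k] e by simp
    have \<phi>: "?\<phi> (b i) = i" "?\<phi> (b j) = j" using the_inv_into_f_f[OF b(1)] e by auto
    show "ends (Ktilde t) (?\<psi> e) = ?\<phi> ` ends H e"
      using \<psi> \<phi> \<epsilon>[of i j s] e unfolding H_def H1_def Ktilde_def by simp
    show "sgn (Ktilde t) (?\<psi> e) = sgn H e"
      using \<psi> \<epsilon>[of i j s] e unfolding H_def H1_def Ktilde_def by simp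
  qed
  then show ?thesis using minor_trans[OF m2 m1] unfolding has_minor_def by blast
qed

lemma signed_graph_contract_edge:
  assumes G: "signed_graph G" and e: "e \<in> edges G" "ends G e = {u, v}" "u \<noteq> v"
  shows "signed_graph (contract_edge G e u v)"
  unfolding signed_graph_def
proof (intro conjI ballI)
  let ?H = "contract_edge G e u v"
  show "finite (verts ?H)" "finite (edges ?H)"
    using G unfolding signed_graph_def contract_edge_def by auto
  have u: "u \<in> verts G" using G e unfolding signed_graph_def by auto
  fix f assume "f \<in> edges ?H"
  then have "f \<in> edges G" unfolding contract_edge_def by simp
  then have f: "ends G f \<subseteq> verts G" "1 \<le> card (ends G f)" "card (ends G f) \<le> 2"
    using G unfolding signed_graph_def by auto
  show "ends ?H f \<subseteq> verts ?H" using f(1) u e(3) unfolding contract_edge_def by auto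
  have "finite (ends G f)" "ends G f \<noteq> {}" using f(2) card.infinite by fastforce+
  then have "finite (ends ?H f)" "ends ?H f \<noteq> {}" unfolding contract_edge_def by auto
  then show "1 \<le> card (ends ?H f)" by (simp add: Suc_leI card_gt_0_iff)
  have "ends ?H f = (\<lambda>x. if x = v then u else x) ` ends G f" by (simp add: contract_edge_def)
  then show "card (ends ?H f) \<le> 2"
    using order_trans[OF card_image_le[OF \<open>finite (ends G f)\<close>] f(3)] by metis
qed

text \<open>Positive edges inside the branch sets are contracted one at a time until all sets are
  singletons, while edges of either sign between different sets survive. Only positive edges may be
  contracted, hence connectivity in \<open>joined G True\<close>.\<close>

lemma Ktilde_minor_of_branch_sets:
  fixes G :: "('v, 'e) sgraph"
  assumes "signed_graph G"
    and "\<And>i. i < t \<Longrightarrow> B i \<subseteq> verts G \<and> conn (joined G True) (B i)"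
    and "\<And>i j. i < t \<Longrightarrow> j < t \<Longrightarrow> i \<noteq> j \<Longrightarrow> B i \<inter> B j = {}"
    and "\<And>i j s. i < j \<Longrightarrow> j < t \<Longrightarrow> touch (joined G s) (B i) (B j)"
  shows "has_minor G (Ktilde t)"
  using assms
proof (induction "card (verts G)" arbitrary: G B rule: less_induct)
  case less
  note G = less.prems(1) and B = less.prems(2) and disj = less.prems(3) and tch = less.prems(4)
  show ?case
  proof (cases "\<exists>i<t. \<exists>u\<in>B i. B i \<noteq> {u}")
    case False
    define b where "b i = (SOME x. x \<in> B i)" for i
    have Bb: "B i = {b i}" if i: "i < t" for i
    proof -
      have "b i \<in> B i" unfolding b_def using conn_nonempty B[OF i] some_in_eq by blast
      then show ?thesis using False i by blast
    qed
    show ?thesis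
    proof (rule Ktilde_minor_of_vertices[OF G])
      show "inj_on b {..<t}"
      proof (rule inj_onI)
        fix i j assume "i \<in> {..<t}" "j \<in> {..<t}" "b i = b j"
        then show "i = j" using disj[of i j] Bb[of i] Bb[of j] by auto
      qed
      show "b ` {..<t} \<subseteq> verts G" using B Bb by fastforce
      show "joined G s (b i) (b j)" if "i < j" "j < t" for i j s
        using tch[OF that, of s] Bb[of i] Bb[of j] that unfolding touch_def by auto
    qed
  next
    case True
    then obtain i0 u where i0: "i0 < t" "u \<in> B i0" "B i0 \<noteq> {u}" by blast
    then have "touch (joined G True) {u} (B i0 - {u})"
      using conn_cut[of "joined G True" "B i0" "{u}"] B by blast
    then obtain v e where v: "v \<in> B i0" "v \<noteq> u" and e: "e \<in> edges G" "ends G e = {u, v}" "sgn G e"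
      unfolding touch_def joined_def by blast
    define \<phi> where "\<phi> x = (if x = v then u else x)" for x
    define H where "H = contract_edge G e u v"
    have uv: "u \<noteq> v" using v by simp
    \<comment> \<open>The contracted edge has coinciding end images, so every edge with distinct
      images survives and keeps its sign.\<close>
    have step: "joined H s (\<phi> x) (\<phi> y)" if j: "joined G s x y" and ne: "\<phi> x \<noteq> \<phi> y" for s x y
    proof -
      obtain f where f: "f \<in> edges G" "ends G f = {x, y}" "sgn G f = s"
        using j unfolding joined_def by blast
      have "f \<noteq> e" using f(2) e(2) ne unfolding \<phi>_def by (auto simp: doubleton_eq_iff)
      then show ?thesis unfolding joined_def H_def contract_edge_def \<phi>_def
        using f by (intro bexI[of _ f]) auto
    qed
    have disj': "\<phi> ` B i \<inter> \<phi> ` B j = {}" if ij: "i < t" "j < t" "i \<noteq> j" for i j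
    proof -
      have "False" if "x \<in> B i" "y \<in> B j" "\<phi> x = \<phi> y" for x y
      proof -
        have "x = y \<or> (x \<in> {u, v} \<and> y \<in> {u, v})" using that(3) unfolding \<phi>_def by (auto split: if_splits)
        then have "x = y \<or> (x \<in> B i0 \<and> y \<in> B i0)" using i0 v by auto
        then show False using that(1,2) disj[of i j] disj[of i i0] disj[of j i0] ij i0(1) by blast
      qed
      then show ?thesis by blast
    qed
    have vG: "v \<in> verts G" using B[OF i0(1)] v by blast
    have uG: "u \<in> verts G" using B[OF i0(1)] i0 by blast
    have "has_minor H (Ktilde t)"
    proof (rule less.hyps)
      have "finite (verts G)" using G unfolding signed_graph_def by simp
      then show "card (verts H) < card (verts G)"
        unfolding H_def contract_edge_def using vG card_gt_0_iff[of "verts G"] by auto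
      show "signed_graph H" unfolding H_def by (rule signed_graph_contract_edge[OF G e(1,2) uv])
      show "\<phi> ` B i \<subseteq> verts H \<and> conn (joined H True) (\<phi> ` B i)" if "i < t" for i
      proof
        show "\<phi> ` B i \<subseteq> verts H"
          using B[OF that] uG uv unfolding H_def contract_edge_def \<phi>_def by auto
        show "conn (joined H True) (\<phi> ` B i)"
          by (rule conn_image[of "joined G True"]) (use B[OF that] step in auto)
      qed
      show "\<phi> ` B i \<inter> \<phi> ` B j = {}" if "i < t" "j < t" "i \<noteq> j" for i j
        using disj' that by blast
      show "touch (joined H s) (\<phi> ` B i) (\<phi> ` B j)" if ij: "i < j" "j < t" for i j s
      proof -
        obtain x y where xy: "x \<in> B i" "y \<in> B j" "joined G s x y"
          using tch[OF ij] unfolding touch_def by blast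
        then have "\<phi> x \<noteq> \<phi> y" using disj'[of i j] ij by auto
        then show ?thesis using step[OF xy(3)] xy unfolding touch_def by blast
      qed
    qed
    moreover have "minor G H" unfolding H_def
      by (rule minor.step[OF minor.refl minor_step.contr[OF e(1,3,2) uv]])
    ultimately show ?thesis by (rule has_minor_trans[rotated])
  qed
qed

subsection \<open>Potentials and balanced sets\<close>

text \<open>Here \<open>b\<close> is the sign that the edge has after switching at the vertices with label
  True.\<close>

definition rel_joined :: "('v, 'e) sgraph \<Rightarrow> ('v \<Rightarrow> bool) \<Rightarrow> bool \<Rightarrow> 'v \<Rightarrow> 'v \<Rightarrow> bool" where
  "rel_joined G p b x y \<longleftrightarrow> (\<exists>e\<in>edges G. ends G e = {x, y} \<and> (sgn G e = (p x = p y)) = b)"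

lemma rel_joined_sym: "symp (rel_joined G p b)"
  unfolding rel_joined_def symp_def by (auto simp: insert_commute eq_commute)

lemma rel_joined_cong:
  "p x = p' x \<Longrightarrow> p y = p' y \<Longrightarrow> rel_joined G p b x y = rel_joined G p' b x y"
  unfolding rel_joined_def by simp

text \<open>Each position contributes an even amount to the three counts together. If
  \<open>ys\<close> is a rearrangement of \<open>xs\<close>, the last two counts agree, so
  \<open>N\<close> holds an even number of times.\<close>

lemma even_sign_changes:
  assumes "length xs = length es" "length ys = length es"
    and "\<And>i. i < length es \<Longrightarrow> N (es ! i) \<longleftrightarrow> p (xs ! i) \<noteq> p (ys ! i)"
  shows "even (length (filter N es) + length (filter p xs) + length (filter p ys))"
  using assms
proof (induction es arbitrary: xs ys)
  case Nil
  then show ?case by simp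
next
  case (Cons e es)
  obtain x xs' y ys' where xy: "xs = x # xs'" "ys = y # ys'"
    using Cons.prems by (metis length_Suc_conv)
  have "even (length (filter N es) + length (filter p xs') + length (filter p ys'))"
    by (rule Cons.IH) (use Cons.prems(1,2) Cons.prems(3)[of "Suc _"] xy in auto)
  moreover have "N e \<longleftrightarrow> p x \<noteq> p y" using Cons.prems(3)[of 0] xy by simp
  ultimately show ?case using xy by auto
qed

text \<open>Inside \<open>X\<close> the negative edges are exactly those along which the label
  \<open>p\<close> changes, and around a cycle it changes an even number of times.\<close>

lemma balanced_if_potential:
  assumes X: "X \<subseteq> verts G" and pot: "\<And>x y. x \<in> X \<Longrightarrow> y \<in> X \<Longrightarrow> \<not> rel_joined G p False x y"
  shows "balanced G X"
  unfolding balanced_def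
proof (intro conjI notI X)
  assume "\<exists>vs es. negative_cycle G vs es \<and> set vs \<subseteq> X"
  then obtain vs es where c: "is_cycle G vs es" "odd (length (filter (\<lambda>e. \<not> sgn G e) es))"
    and vs: "set vs \<subseteq> X" unfolding negative_cycle_def by blast
  have len: "length vs = length es" "length es \<ge> 1" "set es \<subseteq> edges G"
    and en: "\<And>i. i < length es \<Longrightarrow> ends G (es ! i) = {vs ! i, vs ! ((i + 1) mod length vs)}"
    using c(1) unfolding is_cycle_def by auto
  have "even (length (filter (\<lambda>e. \<not> sgn G e) es) + length (filter p vs) + length (filter p (rotate1 vs)))"
  proof (rule even_sign_changes)
    show "length vs = length es" "length (rotate1 vs) = length es" using len by auto
    fix i assume i: "i < length es"
    let ?j = "(i + 1) mod length vs"
    have j: "?j < length vs" using i len by (intro mod_less_divisor) linarith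
    have "\<not> rel_joined G p False (vs ! i) (vs ! ?j)"
      using pot vs i j len(1) nth_mem by (metis subsetD)
    then have "sgn G (es ! i) \<longleftrightarrow> p (vs ! i) = p (vs ! ?j)"
      using en[OF i] i len(3) nth_mem unfolding rel_joined_def by blast
    then show "\<not> sgn G (es ! i) \<longleftrightarrow> p (vs ! i) \<noteq> p (rotate1 vs ! i)"
      using nth_rotate1[of i vs] i len(1) by simp
  qed
  moreover have "length (filter p (rotate1 vs)) = length (filter p vs)" by (cases vs) auto
  ultimately show False using c(2) by simp
qed

text \<open>The quotient by \<open>P\<close> is an ordinary graph with every adjacency doubled into
  both signs, the shape of \<open>Ktilde\<close>; this is why clique minors of the unsigned quotient
  suffice.\<close>

definition potential_partition :: "('v, 'e) sgraph \<Rightarrow> ('v \<Rightarrow> bool) \<Rightarrow> 'v set set \<Rightarrow> bool" where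
  "potential_partition G p P \<longleftrightarrow> (\<forall>X\<in>P. conn (rel_joined G p True) X) \<and>
    (\<forall>X\<in>P. \<forall>x\<in>X. \<forall>y\<in>X. \<not> rel_joined G p False x y) \<and>
    (\<forall>X\<in>P. \<forall>Y\<in>P. X \<noteq> Y \<longrightarrow> X \<inter> Y = {} \<and>
      (\<forall>a b. touch (rel_joined G p a) X Y \<longrightarrow> touch (rel_joined G p b) X Y))"

lemma potential_partitionD:
  assumes "potential_partition G p P"
  shows "X \<in> P \<Longrightarrow> conn (rel_joined G p True) X"
    and "X \<in> P \<Longrightarrow> x \<in> X \<Longrightarrow> y \<in> X \<Longrightarrow> \<not> rel_joined G p False x y"
    and "X \<in> P \<Longrightarrow> Y \<in> P \<Longrightarrow> X \<noteq> Y \<Longrightarrow> X \<inter> Y = {}"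
    and "X \<in> P \<Longrightarrow> Y \<in> P \<Longrightarrow> X \<noteq> Y \<Longrightarrow> touch (rel_joined G p a) X Y \<Longrightarrow>
      touch (rel_joined G p b) X Y"
  using assms unfolding potential_partition_def by (simp, simp, simp, metis)

text \<open>A largest connected set \<open>X\<close> that can be switched to all positive is split
  off, and the rest is partitioned recursively. Maximality forces both signs between
  \<open>X\<close> and each outside vertex it touches, whatever label that vertex receives.\<close>

lemma ex_potential_partition:
  assumes G: "signed_graph G" and nl: "\<not> has_negative_loop G" and "U \<subseteq> verts G"
  shows "\<exists>P p. \<Union>P = U \<and> potential_partition G p P"
  using \<open>U \<subseteq> verts G\<close>
proof (induction "card U" arbitrary: U rule: less_induct)
  case less
  have finU: "finite U" using less.prems G finite_subset unfolding signed_graph_def by blast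
  show ?case
  proof (cases "U = {}")
    case True
    then show ?thesis by (intro exI[of _ "{}"]) (auto simp: potential_partition_def)
  next
    case False
    \<comment> \<open>A loop compares a label with itself, so its relative sign is its own; without
      negative loops, singletons are good.\<close>
    have noloop: "\<not> rel_joined G p False x x" for p x
      using nl unfolding rel_joined_def has_negative_loop_def is_loop_def by auto
    define good where "good X \<longleftrightarrow> X \<subseteq> U \<and> (\<exists>p. conn (rel_joined G p True) X \<and>
      (\<forall>x\<in>X. \<forall>y\<in>X. \<not> rel_joined G p False x y))" for X
    obtain u0 where "u0 \<in> U" using False by blast
    then have "good {u0}" unfolding good_def using noloop conn_singleton by fastforce
    moreover have bound: "card X < Suc (card U)" if "good X" for X
      using that card_mono[OF finU, of X] unfolding good_def by (simp add: less_Suc_eq_le)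
    ultimately obtain X where X: "good X" and Xmax: "\<And>Y. good Y \<Longrightarrow> card Y \<le> card X"
      using ex_has_greatest_nat[of good "{u0}" card "Suc (card U)"] by auto
    obtain p0 where p0: "conn (rel_joined G p0 True) X"
      "\<And>x y. x \<in> X \<Longrightarrow> y \<in> X \<Longrightarrow> \<not> rel_joined G p0 False x y" and XU: "X \<subseteq> U"
      using X unfolding good_def by blast
    have finX: "finite X" using XU finU finite_subset by blast
    have lt: "card (U - X) < card U"
      using XU conn_nonempty[OF p0(1)] finU by (intro psubset_card_mono) auto
    obtain P p1 where UP: "\<Union>P = U - X" and pp: "potential_partition G p1 P"
      using less.hyps[OF lt] less.prems by (meson Diff_subset subset_trans)
    note P = UP potential_partitionD[OF pp]
    define p where "p x = (if x \<in> X then p0 x else p1 x)" for x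
    have pX: "rel_joined G p b x y = rel_joined G p0 b x y" if "x \<in> X" "y \<in> X" for b x y
      by (rule rel_joined_cong) (use that in \<open>auto simp: p_def\<close>)
    have pP: "rel_joined G p b x y = rel_joined G p1 b x y" if "x \<notin> X" "y \<notin> X" for b x y
      by (rule rel_joined_cong) (use that in \<open>auto simp: p_def\<close>)
    have PX: "x \<notin> X" if "Y \<in> P" "x \<in> Y" for Y x using P(1) that by blast
    have connX: "conn (rel_joined G p True) X" by (rule conn_cong[OF p0(1)]) (simp add: pX)
    have potX: "\<not> rel_joined G p False x y" if "x \<in> X" "y \<in> X" for x y
      using p0(2) that pX by blast
    \<comment> \<open>If an outside vertex \<open>u\<close> saw \<open>X\<close> in only one relative sign, then \<open>insert u X\<close>
      would be a larger good set.\<close>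
    have both: "touch (rel_joined G p b) X {u}"
      if u: "u \<in> U - X" and a: "touch (rel_joined G p a) X {u}" for u a b
    proof (rule ccontr)
      assume n: "\<not> touch (rel_joined G p b) X {u}"
      then have "a \<noteq> b" using a by blast
      \<comment> \<open>The label of \<open>u\<close> is kept if \<open>a\<close> is True and
        flipped otherwise, so that edges of relative sign \<open>a\<close> from \<open>X\<close> to
        \<open>u\<close> become positive.\<close>
      define p' where "p' = p(u := (p u = a))"
      have flip: "rel_joined G p' True x u = rel_joined G p a x u"
        "rel_joined G p' False x u = rel_joined G p b x u" if "x \<in> X" for x
      proof -
        have "p' x = p x" "p' u = (p u = a)" using that u unfolding p'_def by auto
        moreover have "((s = (q = (q' = a))) = True) = ((s = (q = q')) = a)"
          "((s = (q = (q' = a))) = False) = ((s = (q = q')) = b)" for s q q'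
          using \<open>a \<noteq> b\<close> by (cases a; cases b; auto)+
        ultimately show "rel_joined G p' True x u = rel_joined G p a x u"
          "rel_joined G p' False x u = rel_joined G p b x u"
          unfolding rel_joined_def by presburger+
      qed
      have p'X: "rel_joined G p' c x y = rel_joined G p c x y" if "x \<in> X" "y \<in> X" for c x y
        by (rule rel_joined_cong) (use that u in \<open>auto simp: p'_def\<close>)
      have "conn (rel_joined G p' True) X" by (rule conn_cong[OF connX]) (simp add: p'X)
      moreover have "touch (rel_joined G p' True) X {u}" using a flip(1) unfolding touch_def by auto
      ultimately have "conn (rel_joined G p' True) (X \<union> {u})"
        by (intro conn_Un[OF rel_joined_sym _ conn_singleton] disjI1)
      moreover have "\<not> rel_joined G p' False x y" if "x \<in> X \<union> {u}" "y \<in> X \<union> {u}" for x y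
      proof -
        have *: "\<not> rel_joined G p' False x u" if "x \<in> X" for x
          using n flip(2)[OF that] that unfolding touch_def by auto
        show ?thesis
          using that * noloop p'X potX sympD[OF rel_joined_sym, of G p' False u] by blast
      qed
      ultimately have "good (X \<union> {u})" using XU u unfolding good_def by blast
      then show False using Xmax[of "X \<union> {u}"] u finX by simp
    qed
    have XY: "touch (rel_joined G p b) X Y" if Y: "Y \<in> P" and a: "touch (rel_joined G p a) X Y" for Y a b
    proof -
      obtain u where u: "u \<in> Y" "touch (rel_joined G p a) X {u}" using a unfolding touch_def by blast
      then have "touch (rel_joined G p b) X {u}" using both Y P(1) by blast
      then show ?thesis using u touch_mono by blast
    qed
    show ?thesis unfolding potential_partition_def
    proof (intro exI conjI ballI allI impI)
      show "\<Union>(insert X P) = U" using P(1) XU by auto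
      show "conn (rel_joined G p True) Y" if "Y \<in> insert X P" for Y
      proof (cases "Y = X")
        case False
        then have "Y \<in> P" using that by blast
        then show ?thesis by (intro conn_cong[OF P(2)]) (auto simp: pP PX)
      qed (simp add: connX)
      show "\<not> rel_joined G p False x y" if "Y \<in> insert X P" "x \<in> Y" "y \<in> Y" for Y x y
      proof (cases "Y = X")
        case False
        then have "Y \<in> P" using that by blast
        then show ?thesis using P(3) that pP PX by blast
      qed (use that potX in blast)
      fix Y Z assume YZ: "Y \<in> insert X P" "Z \<in> insert X P" "Y \<noteq> Z"
      show "Y \<inter> Z = {}" using YZ P(1,4) by blast
      fix a b assume t: "touch (rel_joined G p a) Y Z"
      consider "Y = X" "Z \<in> P" | "Z = X" "Y \<in> P" | "Y \<in> P" "Z \<in> P" using YZ by blast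
      then show "touch (rel_joined G p b) Y Z"
      proof cases
        case 1
        then show ?thesis using XY t by blast
      next
        case 2
        then show ?thesis using XY t touch_sym[OF rel_joined_sym] by blast
      next
        case 3
        then have eq: "touch (rel_joined G p c) Y Z = touch (rel_joined G p1 c) Y Z" for c
          unfolding touch_def using pP PX by blast
        show ?thesis using P(5)[OF 3 YZ(3)] t eq by blast
      qed
    qed
  qed
qed

section \<open>Heavy balanced sets and the bound on \<open>chi_fb\<close>\<close>

lemma joined_switch_set:
  assumes "rel_joined G p b x y" "x \<noteq> y" "x \<in> verts G" "y \<in> verts G"
  shows "joined (switch_set G {v \<in> verts G. p v}) b x y"
proof -
  obtain e where e: "e \<in> edges G" "ends G e = {x, y}" "(sgn G e = (p x = p y)) = b"
    using assms(1) unfolding rel_joined_def by blast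
  have "\<not> is_loop G e" using e(2) assms(2) unfolding is_loop_def by simp
  moreover have "even (card ({v \<in> verts G. p v} \<inter> {x, y})) \<longleftrightarrow> p x = p y"
    using assms(2-4) by (cases "p x"; cases "p y") (simp_all add: Int_insert_right)
  ultimately have "sgn (switch_set G {v \<in> verts G. p v}) e = b"
    using e(2,3) by (simp add: switch_set_def)
  then show ?thesis unfolding joined_def using e(1,2)
    by (intro bexI[of _ e]) (simp_all add: switch_set_def)
qed

lemma signed_graph_switch_set: "signed_graph G \<Longrightarrow> signed_graph (switch_set G A)"
  unfolding signed_graph_def switch_set_def by simp

text \<open>The heavy stable set is taken in the simple graph \<open>adj\<close> on the parts, each
  part weighted by the total weight of its vertices.\<close>

lemma heavy_balanced_set:
  fixes G :: "('v, 'e) sgraph" and w :: "'v \<Rightarrow> real"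
  assumes G: "signed_graph G" and nl: "\<not> has_negative_loop G"
    and nm: "\<not> has_minor G (Ktilde (Suc n))" and n: "n \<ge> 1" and w: "\<And>v. w v \<ge> 0"
  shows "\<exists>X. balanced G X \<and> sum w (verts G) \<le> 2 * real n * sum w X"
proof -
  obtain P p where UP: "\<Union>P = verts G" and pp: "potential_partition G p P"
    using ex_potential_partition[OF G nl order_refl] by blast
  note P = UP potential_partitionD[OF pp]
  define adj where "adj X Y \<longleftrightarrow> X \<in> P \<and> Y \<in> P \<and> X \<noteq> Y \<and> touch (rel_joined G p True) X Y" for X Y
  have sym: "symp adj" unfolding adj_def symp_def using touch_sym[OF rel_joined_sym] by blast
  have irr: "irreflp adj" unfolding adj_def irreflp_def by blast
  have finV: "finite (verts G)" using G unfolding signed_graph_def by simp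
  then have finP: "finite P" using P(1) finite_UnionD by metis
  have finX: "finite X" if "X \<in> P" for X using that UP finV by (metis Union_upper finite_subset)
  have wU: "sum w (\<Union>T) = sum (sum w) T" if "T \<subseteq> P" for T
    using sum.Union_disjoint[of T w] that P(4) finX by (simp add: subset_iff)
  \<comment> \<open>A clique minor with \<open>n + 1\<close> branch sets of parts unfolds to
    disjoint vertex sets of \<open>G\<close>; after switching by \<open>p\<close> these are
    positively connected and pairwise joined by edges of both signs, which gives
    \<open>Ktilde (Suc n)\<close>.\<close>
  have cl: "card K \<le> n" if K: "clique_minor adj P K" for K
  proof (rule ccontr)
    assume "\<not> card K \<le> n"
    then obtain K' where K': "K' \<subseteq> K" "card K' = Suc n" "finite K'"
      using obtain_subset_with_card_n[of "Suc n" K] by (metis not_less_eq_eq)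
    then have K'c: "clique_minor adj P K'" using K clique_minor_subset by blast
    obtain h where h: "bij_betw h {..<Suc n} K'"
      using ex_bij_betw_nat_finite[OF K'(3)] K'(2) by (auto simp: lessThan_atLeast0)
    have hK: "h i \<in> K'" if "i < Suc n" for i using h that by (auto simp: bij_betw_def)
    have hne: "h i \<noteq> h j" if "i < Suc n" "j < Suc n" "i \<noteq> j" for i j
      using h that by (auto simp: bij_betw_def inj_on_def)
    have hP: "h i \<subseteq> P" "conn adj (h i)" if "i < Suc n" for i
      using K'c hK[OF that] unfolding clique_minor_def by auto
    define H where "H = switch_set G {v \<in> verts G. p v}"
    define B where "B i = \<Union>(h i)" for i
    have BV: "B i \<subseteq> verts G" if "i < Suc n" for i using hP[OF that] P(1) unfolding B_def by blast
    have toH: "joined H s x y" if "rel_joined G p s x y" "x \<noteq> y" "x \<in> verts G" "y \<in> verts G" for s x y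
      unfolding H_def by (rule joined_switch_set[OF that])
    have Bd: "B i \<inter> B j = {}" if ij: "i < Suc n" "j < Suc n" "i \<noteq> j" for i j
    proof -
      have "h i \<inter> h j = {}" using K'c hK[OF ij(1)] hK[OF ij(2)] hne[OF ij] by (simp add: clique_minor_def)
      then have "X \<inter> Y = {}" if "X \<in> h i" "Y \<in> h j" for X Y
        using that P(4)[of X Y] hP(1)[OF ij(1)] hP(1)[OF ij(2)] by blast
      then show ?thesis unfolding B_def by blast
    qed
    have "has_minor H (Ktilde (Suc n))"
    proof (rule Ktilde_minor_of_branch_sets)
      show "signed_graph H" unfolding H_def by (rule signed_graph_switch_set[OF G])
      show "B i \<subseteq> verts H \<and> conn (joined H True) (B i)" if i: "i < Suc n" for i
      proof
        show "B i \<subseteq> verts H" using BV[OF i] unfolding H_def switch_set_def by simp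
        have "conn (rel_joined G p True) (B i)" unfolding B_def
          by (rule conn_Union[OF hP(2)[OF i]]) (use hP(1)[OF i] P(2) in \<open>auto simp: adj_def\<close>)
        then show "conn (joined H True) (B i)" by (rule conn_cong) (use toH BV[OF i] in auto)
      qed
      show "B i \<inter> B j = {}" if "i < Suc n" "j < Suc n" "i \<noteq> j" for i j using Bd that by blast
      show "touch (joined H s) (B i) (B j)" if ij: "i < j" "j < Suc n" for i j s
      proof -
        have "touch adj (h i) (h j)" using K'c hK[of i] hK[of j] hne[of i j] ij by (simp add: clique_minor_def)
        then obtain X Y where XY: "X \<in> h i" "Y \<in> h j" "adj X Y" unfolding touch_def by blast
        then have "touch (rel_joined G p s) X Y" using P(5) unfolding adj_def by blast
        then obtain x y where xy: "x \<in> B i" "y \<in> B j" "rel_joined G p s x y"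
          using XY unfolding touch_def B_def by blast
        moreover have "x \<noteq> y" using xy Bd[of i j] ij by auto
        ultimately show ?thesis using toH[of s x y] BV[of i] BV[of j] ij unfolding touch_def by force
      qed
    qed
    moreover have "minor G H" unfolding H_def by (rule minor_switch_set) (use finV in auto)
    ultimately show False using nm has_minor_trans by blast
  qed
  obtain T where T: "T \<subseteq> P" "\<not> touch adj T T" "sum (sum w) P \<le> 2 * real n * sum (sum w) T"
    using heavy_stable_set[OF sym irr finP, of "sum w" n] cl n w by (metis sum_nonneg)
  \<comment> \<open>The labels \<open>p\<close> serve as potential on the whole union: an edge of
    either relative sign between two parts in \<open>T\<close> would make them adjacent.\<close>
  have "balanced G (\<Union>T)"
  proof (rule balanced_if_potential)
    show "\<Union>T \<subseteq> verts G" using T(1) P(1) by blast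
    fix x y assume xy: "x \<in> \<Union>T" "y \<in> \<Union>T"
    then obtain X Y where XY: "X \<in> T" "x \<in> X" "Y \<in> T" "y \<in> Y" by blast
    show "\<not> rel_joined G p False x y"
    proof (cases "X = Y")
      case True
      then show ?thesis using P(3) XY T(1) by blast
    next
      case False
      have "\<not> adj X Y" using T(2) XY unfolding touch_def by blast
      then have "\<not> touch (rel_joined G p True) X Y" using XY False T(1) unfolding adj_def by blast
      then have "\<not> touch (rel_joined G p False) X Y" using P(5)[of X Y] XY False T(1) by blast
      then show ?thesis using XY unfolding touch_def by blast
    qed
  qed
  then show ?thesis using T(3) wU[OF T(1)] wU[of P] P(1) by auto
qed

lemma chi_fb_le:
  assumes "fractional_balanced_coloring G w"
  shows "chi_fb G \<le> (\<Sum>X\<in>{X. balanced G X}. w X)"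
  unfolding chi_fb_def
proof (rule cInf_lower)
  show "bdd_below {(\<Sum>X\<in>{X. balanced G X}. w X) | w. fractional_balanced_coloring G w}"
    by (rule bdd_belowI[of _ 0]) (auto simp: fractional_balanced_coloring_def intro!: sum_nonneg)
qed (use assms in blast)

theorem theorem5p1:
  fixes G :: "('v, 'e) sgraph" and t :: nat
  assumes "t \<ge> 1"
    and "signed_graph G"
    and "\<not> has_negative_loop G"
    and "\<not> has_minor G (Ktilde t)"
  shows "chi_fb G \<le> 2 * real t - 2"
proof (cases "t = 1")
  case True
  \<comment> \<open>\<open>Ktilde 1\<close> is a single vertex, so excluding it leaves the empty
    graph. The case is separate because \<open>r\<close> below would be 0.\<close>
  have "verts G = {}"
  proof (rule ccontr)
    assume "verts G \<noteq> {}"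
    then obtain v where "v \<in> verts G" by blast
    then have "has_minor G (Ktilde t)"
      by (intro Ktilde_minor_of_vertices[OF assms(2), of "\<lambda>_. v"]) (auto simp: True inj_on_def)
    then show False using assms(4) by blast
  qed
  then have "fractional_balanced_coloring G (\<lambda>_. 0)" unfolding fractional_balanced_coloring_def by simp
  from chi_fb_le[OF this] show ?thesis using True by simp
next
  case False
  define n where "n = t - 1"
  have n: "n \<ge> 1" "t = Suc n" using assms(1) False unfolding n_def by auto
  define r where "r = 2 * real n"
  have r: "r > 0" "r = 2 * real t - 2" using n unfolding r_def by auto
  let ?\<B> = "{X. balanced G X}"
  have finV: "finite (verts G)" using assms(2) unfolding signed_graph_def by simp
  have fin\<B>: "finite ?\<B>"
    by (rule finite_subset[of _ "Pow (verts G)"]) (use finV in \<open>auto simp: balanced_def\<close>)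
  have heavy: "\<exists>S\<in>?\<B>. S \<subseteq> verts G \<and> sum w (verts G) \<le> r * sum w S"
    if "\<And>v. w v \<ge> 0" for w :: "'v \<Rightarrow> real"
    using heavy_balanced_set[OF assms(2,3), of n w] assms(4) n that
    unfolding r_def balanced_def by blast
  \<comment> \<open>Dividing the distribution by \<open>1 / r - \<epsilon>\<close> brings every
    coverage to at least 1 and the total weight to \<open>1 / (1 / r - \<epsilon>)\<close>.\<close>
  have approx: "chi_fb G * (1 / r - \<epsilon>) \<le> 1" if \<epsilon>: "0 < \<epsilon>" "\<epsilon> < 1 / r" for \<epsilon>
  proof -
    obtain p where p: "\<And>S. p S \<ge> (0::real)" "\<And>S. S \<notin> ?\<B> \<Longrightarrow> p S = 0" "sum p ?\<B> = 1"
      "\<And>v. v \<in> verts G \<Longrightarrow> sum p {S \<in> ?\<B>. v \<in> S} \<ge> 1 / r - \<epsilon>"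
      using convex_cover_approx[OF finV fin\<B> r(1) heavy \<epsilon>(1)] by blast
    define d where "d = 1 / r - \<epsilon>"
    have d: "d > 0" using \<epsilon> unfolding d_def by simp
    have "fractional_balanced_coloring G (\<lambda>S. p S / d)"
      unfolding fractional_balanced_coloring_def
      using p d by (auto simp: sum_divide_distrib[symmetric] d_def[symmetric])
    from chi_fb_le[OF this] have "chi_fb G \<le> 1 / d" using p(3) by (simp add: sum_divide_distrib[symmetric])
    then show ?thesis using d unfolding d_def by (simp add: field_simps)
  qed
  \<comment> \<open>The limit of \<open>\<epsilon>\<close> to 0: if \<open>chi_fb G\<close> exceeded
    \<open>r\<close>, a \<open>d\<close> strictly between \<open>1 / chi_fb G\<close> and
    \<open>1 / r\<close> would contradict \<open>approx\<close> for
    \<open>\<epsilon> = 1 / r - d\<close>.\<close>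
  have "chi_fb G \<le> r"
  proof (rule ccontr)
    assume c: "\<not> chi_fb G \<le> r"
    then have pos: "chi_fb G > 0" "1 / chi_fb G < 1 / r" using r(1) by (auto simp: field_simps)
    then obtain d where d: "1 / chi_fb G < d" "d < 1 / r" using dense by blast
    have "0 < 1 / chi_fb G" using pos(1) by simp
    then have "0 < d" using d(1) by linarith
    then have "chi_fb G * d \<le> 1" using approx[of "1 / r - d"] d(2) by simp
    then show False using d(1) pos(1) by (simp add: field_simps)
  qed
  then show ?thesis using r(2) by simp
qed

end
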